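(* Let $\alpha > 1$ and let $p \ge 2$ be an integer. Let $\mu_1,\ldots,\mu_p$ be fixed centered probability laws on $\mathbb{R}$ with unit variance, such that $\mu_1,\ldots,\mu_{p-1}$ have a finite moment of order $4\alpha$ and $\mu_p$ has a finite moment of order $2\alpha$. For all integers $n_0,\ldots,n_p \ge 1$, let $A^{(1)} \in \mathbb{R}^{n_0\times n_1}, \ldots, A^{(p)} \in \mathbb{R}^{n_{p-1}\times n_p}$ be independent random matrices such that, for each $q$, the entries of $A^{(q)}$ are i.i.d. with law $\mu_q$, and let $P := A^{(1)} \cdots A^{(p)} \in \mathbb{R}^{n_0 \times n_p}$. Then $$n_p^{-1}(n_1 \cdots n_{p-1})^{-\frac 1 2} \|P\|_{\ell^\infty \to \ell^\infty} \xrightarrow[n_0 \asymp \cdots \asymp n_p \to \infty]{\text{(prob.)}} \sqrt{\frac 2 \pi}.$$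
   Context: For a matrix $A = (A_{ij}) \in \mathbb{R}^{m\times n}$, $\|A\|_{\ell^\infty \to \ell^\infty} := \sup_{|x|_\infty \le 1} |Ax|_\infty = \max_{1 \le i \le m} \sum_{j = 1}^n |A_{ij}|$, where $|x|_\infty=\max_j|x_j|$. For random variables $U(n_0,\ldots,n_p)$ and $X$, the notation $U(n_0,\ldots, n_p) \xrightarrow[n_0 \asymp \cdots \asymp n_p \to \infty]{\text{(prob.)}} X$ means: for every $C < +\infty$ and $\varepsilon,\delta > 0$, there exists $N \in \mathbb{N}$ such that if $N \le n_q \le C n_{q'}$ for all $q,q' \in \{0,\ldots, p\}$, then $\mathbb{P}[|U(n_0,\ldots,n_p) - X| \ge \varepsilon] \le \delta$. *)

theory Defs
  imports "HOL-Probability.Probability" "Jordan_Normal_Form.Matrix"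
begin

text \<open>Matrices and vectors are those of Jordan_Normal_Form, whose dimensions are values, and whose
  indices start at 0. \<open>Matrix.vec\<close> is qualified because HOL-Analysis also has a type \<open>vec\<close>.\<close>

definition vec_norm_inf :: "real Matrix.vec \<Rightarrow> real" where
  "vec_norm_inf x = Max ((\<lambda>j. \<bar>Matrix.vec_index x j\<bar>) ` {..<dim_vec x})"

definition op_norm_inf :: "real mat \<Rightarrow> real" where
  "op_norm_inf A =
     Sup {vec_norm_inf (A *\<^sub>v x) | x. x \<in> carrier_vec (dim_col A) \<and> vec_norm_inf x \<le> 1}"

lemma vec_norm_inf_ge:
  assumes "j < dim_vec x"
  shows "\<bar>Matrix.vec_index x j\<bar> \<le> vec_norm_inf x"
  unfolding vec_norm_inf_def
proof (rule Max_ge)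
  show "finite ((\<lambda>j. \<bar>Matrix.vec_index x j\<bar>) ` {..<dim_vec x})"
    by (rule finite_imageI) (rule finite_lessThan)
  show "\<bar>Matrix.vec_index x j\<bar> \<in> (\<lambda>j. \<bar>Matrix.vec_index x j\<bar>) ` {..<dim_vec x}"
    by (rule imageI) (simp add: assms)
qed

lemma vec_norm_inf_le:
  assumes "0 < dim_vec x" "\<And>j. j < dim_vec x \<Longrightarrow> \<bar>Matrix.vec_index x j\<bar> \<le> b"
  shows "vec_norm_inf x \<le> b"
  unfolding vec_norm_inf_def
proof (rule Max.boundedI)
  show "finite ((\<lambda>j. \<bar>Matrix.vec_index x j\<bar>) ` {..<dim_vec x})"
    by (rule finite_imageI) (rule finite_lessThan)
  show "(\<lambda>j. \<bar>Matrix.vec_index x j\<bar>) ` {..<dim_vec x} \<noteq> {}"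
    unfolding image_is_empty using assms(1) by (metis empty_iff lessThan_iff)
  fix y assume "y \<in> (\<lambda>j. \<bar>Matrix.vec_index x j\<bar>) ` {..<dim_vec x}"
  then show "y \<le> b" by (rule imageE) (simp only: assms(2) lessThan_iff)
qed

lemma op_norm_inf_eq_Max:
  assumes "0 < dim_row A" "0 < dim_col A"
  shows "op_norm_inf A = Max ((\<lambda>i. \<Sum>j<dim_col A. \<bar>A $$ (i, j)\<bar>) ` {..<dim_row A})"
proof -
  define m n where mn: "m = dim_row A" "n = dim_col A"
  define R where "R i = (\<Sum>j<n. \<bar>A $$ (i, j)\<bar>)" for i
  have fin: "finite (R ` {..<m})" by (rule finite_imageI) (rule finite_lessThan)
  have ne: "R ` {..<m} \<noteq> {}"
    unfolding image_is_empty using assms(1) by (metis empty_iff lessThan_iff mn(1))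
  have idx: "Matrix.vec_index (A *\<^sub>v x) i = (\<Sum>j<n. A $$ (i, j) * Matrix.vec_index x j)"
    if "i < m" "x \<in> carrier_vec n" for i x
  proof -
    have "Matrix.vec_index (A *\<^sub>v x) i = scalar_prod (Matrix.row A i) x"
      by (rule index_mult_mat_vec[OF that(1)[unfolded mn]])
    also have "\<dots> = (\<Sum>j\<in>{0..<n}. Matrix.vec_index (Matrix.row A i) j * Matrix.vec_index x j)"
      unfolding scalar_prod_def carrier_vecD[OF that(2)] ..
    also have "\<dots> = (\<Sum>j<n. A $$ (i, j) * Matrix.vec_index x j)"
      unfolding atLeast0LessThan using that(1) by (intro sum.cong refl) (simp add: mn)
    finally show ?thesis .
  qed
  have dim: "dim_vec (A *\<^sub>v x) = m" for x by (simp add: mn)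
  have ub: "vec_norm_inf (A *\<^sub>v x) \<le> Max (R ` {..<m})"
    if x: "x \<in> carrier_vec n" "vec_norm_inf x \<le> 1" for x
  proof (rule vec_norm_inf_le)
    show "0 < dim_vec (A *\<^sub>v x)" using assms(1) by (simp add: dim mn)
    fix i assume "i < dim_vec (A *\<^sub>v x)"
    then have i: "i < m" by (simp only: dim)
    have "\<bar>Matrix.vec_index (A *\<^sub>v x) i\<bar> \<le> (\<Sum>j<n. \<bar>A $$ (i, j) * Matrix.vec_index x j\<bar>)"
      unfolding idx[OF i x(1)] by (rule sum_abs)
    also have "\<dots> \<le> R i"
      unfolding R_def
    proof (rule sum_mono)
      fix j assume "j \<in> {..<n}"
      then have "\<bar>Matrix.vec_index x j\<bar> \<le> 1"
        using vec_norm_inf_ge[of j x] x(2) carrier_vecD[OF x(1)] by simp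
      then show "\<bar>A $$ (i, j) * Matrix.vec_index x j\<bar> \<le> \<bar>A $$ (i, j)\<bar>"
        unfolding abs_mult by (rule mult_left_le) (rule abs_ge_zero)
    qed
    also have "\<dots> \<le> Max (R ` {..<m})"
      by (rule Max_ge[OF fin]) (rule imageI, simp add: i)
    finally show "\<bar>Matrix.vec_index (A *\<^sub>v x) i\<bar> \<le> Max (R ` {..<m})" .
  qed
  obtain i where i: "i < m" "Max (R ` {..<m}) = R i"
    using Max_in[OF fin ne] by (metis imageE lessThan_iff)
  define x where "x = Matrix.vec n (\<lambda>j. sgn (A $$ (i, j)))"
  have x: "x \<in> carrier_vec n" unfolding x_def by (rule vec_carrier)
  have xj: "Matrix.vec_index x j = sgn (A $$ (i, j))" if "j < n" for j
    unfolding x_def by (rule index_vec[OF that])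
  have x1: "vec_norm_inf x \<le> 1"
    by (rule vec_norm_inf_le) (use assms(2) in \<open>simp_all add: carrier_vecD[OF x] mn[symmetric] xj abs_sgn_eq\<close>)
  have "R i = Matrix.vec_index (A *\<^sub>v x) i"
    unfolding idx[OF i(1) x] R_def by (intro sum.cong refl) (simp add: xj abs_sgn)
  also have "\<dots> \<le> vec_norm_inf (A *\<^sub>v x)"
    using vec_norm_inf_ge[of i "A *\<^sub>v x"] i(1) dim[of x] by linarith
  finally have "Max (R ` {..<m}) = vec_norm_inf (A *\<^sub>v x)" using ub[OF x x1] i(2) by linarith
  then have "Max (R ` {..<m}) \<in>
      {vec_norm_inf (A *\<^sub>v x) | x. x \<in> carrier_vec n \<and> vec_norm_inf x \<le> 1}"
    using x x1 by blast
  then have "op_norm_inf A = Max (R ` {..<m})"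
    unfolding op_norm_inf_def mn(2)[symmetric] by (rule cSup_eq_maximum) (use ub in blast)
  then show ?thesis unfolding R_def mn .
qed

text \<open>The product \<open>A 1 * A 2 * \<dots> * A p\<close>, for \<open>p \<ge> 1\<close>.\<close>

definition mat_product :: "nat \<Rightarrow> (nat \<Rightarrow> real mat) \<Rightarrow> real mat" where
  "mat_product p A = foldl (*) (A 1) (map A [2..<Suc p])"

definition centered_unit_variance_law :: "real measure \<Rightarrow> bool" where
  "centered_unit_variance_law \<mu> \<longleftrightarrow> real_distribution \<mu> \<and>
     integrable \<mu> (\<lambda>x. x) \<and> integrable \<mu> (\<lambda>x. x\<^sup>2) \<and>
     prob_space.expectation \<mu> (\<lambda>x. x) = 0 \<and> prob_space.variance \<mu> (\<lambda>x. x) = 1"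

definition finite_moment :: "real measure \<Rightarrow> real \<Rightarrow> bool" where
  "finite_moment \<mu> r \<longleftrightarrow> integrable \<mu> (\<lambda>x. \<bar>x\<bar> powr r)"

definition iid_entries ::
  "'w measure \<Rightarrow> nat \<Rightarrow> nat \<Rightarrow> real measure \<Rightarrow> ('w \<Rightarrow> real mat) \<Rightarrow> bool" where
  "iid_entries M m n \<mu> B \<longleftrightarrow> (\<forall>\<omega>\<in>space M. B \<omega> \<in> carrier_mat m n) \<and>
     prob_space.indep_vars M (\<lambda>_. borel) (\<lambda>ij \<omega>. B \<omega> $$ ij) ({..<m} \<times> {..<n}) \<and>
     (\<forall>ij\<in>{..<m} \<times> {..<n}. distr M borel (\<lambda>\<omega>. B \<omega> $$ ij) = \<mu>)"

text \<open>A tuple \<open>(n\<^sub>0, \<dots>, n\<^sub>p)\<close> is a list \<open>ns\<close> of length \<open>p + 1\<close>, and \<open>A q\<close> has \<open>ns ! (q - 1)\<close> rows and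
  \<open>ns ! q\<close> columns. As there is no sigma-algebra on the type of matrices, independence of the
  matrices is that of their families of entries, as random elements of the product sigma-algebra.\<close>

definition indep_matrices ::
  "'w measure \<Rightarrow> nat \<Rightarrow> nat list \<Rightarrow> (nat \<Rightarrow> 'w \<Rightarrow> real mat) \<Rightarrow> bool" where
  "indep_matrices M p ns A \<longleftrightarrow>
     prob_space.indep_vars M (\<lambda>q. \<Pi>\<^sub>M ij\<in>{..<ns ! (q - 1)} \<times> {..<ns ! q}. borel)
       (\<lambda>q \<omega>. \<lambda>ij\<in>{..<ns ! (q - 1)} \<times> {..<ns ! q}. A q \<omega> $$ ij) {1..p}"

definition conv_prob_comparable ::
  "'w measure \<Rightarrow> nat \<Rightarrow> (nat list \<Rightarrow> 'w \<Rightarrow> real) \<Rightarrow> ('w \<Rightarrow> real) \<Rightarrow> bool" where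
  "conv_prob_comparable M p U X \<longleftrightarrow>
     (\<forall>C \<epsilon> \<delta> :: real. \<epsilon> > 0 \<and> \<delta> > 0 \<longrightarrow>
       (\<exists>N :: nat. \<forall>ns. length ns = p + 1 \<and>
          (\<forall>q\<in>{0..p}. \<forall>q'\<in>{0..p}. N \<le> ns ! q \<and> real (ns ! q) \<le> C * real (ns ! q')) \<longrightarrow>
          measure M {\<omega> \<in> space M. \<bar>U ns \<omega> - X \<omega>\<bar> \<ge> \<epsilon>} \<le> \<delta>))"

end

theory Submission
  imports Defs
begin

text \<open>
  A row of the product is obtained from a unit vector by multiplying it with one independent matrix
  after the other. Conditionally on the row vector x reached so far, the entries of x A are
  independent linear forms in i.i.d. variables. By the Marcinkiewicz--Zygmund inequality, used twice,
  the squared Euclidean norm of x A is within a factor of 1 plus or minus \<open>\<epsilon>\<close> of n times that of x, and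
  no entry of x A exceeds \<open>\<eta>\<close> times the square root of n times the norm of x, outside an event of
  probability \<open>O(n powr -\<alpha>)\<close>. In the last step the sum of the absolute values of the entries of x A is
  equally close to its conditional mean, which the central limit theorem evaluates because no entry
  of x dominates. As \<open>\<alpha> > 1\<close>, the union bound over all rows succeeds, and the operator norm is the
  largest of these row sums.
\<close>

section \<open>Moments of sums of independent variables\<close>

text \<open>The moment orders come from one count. There are n 0 rows, comparable in number to every
  n q, so each failure event of a single row must have probability o(1/n). A moment of order r > 2
  gives a sum of n terms a deviation probability O(n powr (-r/2)), hence r = 2 * \<alpha> with
  \<alpha> > 1. The matrices 1 to p - 1 enter through sums of squares of linear forms, which doubles
  the order to 4 * \<alpha>; the last one enters through absolute values only. The obstacle is that
  the central limit theorem is a limit statement, while here it must hold uniformly over all row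
  vectors and dimensions. An argument by contradiction turns it into a threshold \<eta> for the
  largest entry. The other estimates are homogeneous in x, so their constants depend only on the
  law, the order and the tolerance, and are fixed before x. Since p \<ge> 2, the unit vector, which
  has a dominating entry, is spread out by at least one multiplication before the last.\<close>

lemma one_plus_powr_le:
  fixes r :: real
  assumes "r > 2"
  obtains C where "C \<ge> 1"
    "\<And>t. \<bar>1 + t\<bar> powr r \<le> 1 + r * t + C * (t\<^sup>2 + \<bar>t\<bar> powr r)"
proof -
  \<comment> \<open>C1 dominates the second derivative of \<open>x powr r\<close> for x between 1/2
    and 3/2. C2 serves |t| > 1/2, where |1 + t| \<le> 3 * |t|, and where a negative r * t is
    compensated by means of 1 \<le> (2 * |t|) powr (r - 1).\<close>
  define C1 where "C1 = r * (r - 1) * 2 powr (r - 2)"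
  define C2 where "C2 = 3 powr r + r * 2 powr (r - 1)"
  have C1: "C1 \<ge> 0" using assms by (simp add: C1_def)
  have C2: "C2 \<ge> 1" using assms ge_one_powr_ge_zero[of 3 r] by (simp add: C2_def add_increasing2)
  have "\<bar>1 + t\<bar> powr r \<le> 1 + r * t + (C1 + C2) * (t\<^sup>2 + \<bar>t\<bar> powr r)" for t
  proof (cases "\<bar>t\<bar> \<le> 1/2")
    case True
    have small: "\<bar>1 + t\<bar> powr r \<le> 1 + r * t + C1 * t\<^sup>2"
    \<comment> \<open>\<open>Taylor\<close> asks for a point different from the centre of
      expansion.\<close>
    proof (cases "t = 0")
      case False
      define diff :: "nat \<Rightarrow> real \<Rightarrow> real" where
        "diff = (\<lambda>m x. if m = 0 then x powr r else if m = 1 then r * x powr (r - 1)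
                      else r * (r - 1) * x powr (r - 2))"
      have der: "\<forall>m t. m < 2 \<and> 1/2 \<le> t \<and> t \<le> 3/2 \<longrightarrow> DERIV (diff m) t :> diff (Suc m) t"
      proof (intro allI impI)
        fix m :: nat and t :: real assume H: "m < 2 \<and> 1/2 \<le> t \<and> t \<le> 3/2"
        then consider "m = 0" | "m = 1" by linarith
        then show "DERIV (diff m) t :> diff (Suc m) t"
          using H by cases (auto simp: diff_def intro!: derivative_eq_intros)
      qed
      obtain u where u: "if 1 + t < 1 then 1 + t < u \<and> u < 1 else 1 < u \<and> u < 1 + t"
        and eq: "(1 + t) powr r = (\<Sum>m<2. (diff m 1 / fact m) * (1 + t - 1)^m)
            + (diff 2 u / fact 2) * (1 + t - 1)^2"
      proof -
        have "\<exists>u. (if 1 + t < 1 then 1 + t < u \<and> u < 1 else 1 < u \<and> u < 1 + t) \<and>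
          (1 + t) powr r = (\<Sum>m<2. (diff m 1 / fact m) * (1 + t - 1)^m)
            + (diff 2 u / fact 2) * (1 + t - 1)^2"
          by (rule Taylor[OF _ _ der]) (use True False in \<open>simp_all add: diff_def\<close>)
        then show ?thesis using that by blast
      qed
      have u01: "0 \<le> u" "u \<le> 2" using u True by (auto split: if_splits)
      have "(1 + t) powr r = 1 + r * t + (r * (r - 1) * u powr (r - 2) / 2) * t\<^sup>2"
        using eq by (simp add: diff_def eval_nat_numeral)
      also have "\<dots> \<le> 1 + r * t + C1 * t\<^sup>2"
      proof -
        have "u powr (r - 2) \<le> 2 powr (r - 2)" using u01 assms by (intro powr_mono2) auto
        then have "r * (r - 1) * u powr (r - 2) \<le> C1"
          unfolding C1_def using assms by (intro mult_left_mono) auto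
        moreover have "0 \<le> r * (r - 1) * u powr (r - 2)" using assms by simp
        ultimately show ?thesis by (intro add_left_mono mult_right_mono) auto
      qed
      finally show ?thesis using True by (simp add: abs_le_iff)
    qed simp
    have "0 \<le> C2 * t\<^sup>2" "0 \<le> (C1 + C2) * \<bar>t\<bar> powr r" using C1 C2 by simp_all
    then show ?thesis using small by (simp add: algebra_simps)
  next
    case False
    have "\<bar>1 + t\<bar> powr r \<le> (3 * \<bar>t\<bar>) powr r" using False assms by (intro powr_mono2) auto
    also have "\<dots> = 3 powr r * \<bar>t\<bar> powr r" by (simp add: powr_mult)
    finally have 1: "\<bar>1 + t\<bar> powr r \<le> 3 powr r * \<bar>t\<bar> powr r" .
    have "1 \<le> (2 * \<bar>t\<bar>) powr (r - 1)" using False assms by (intro ge_one_powr_ge_zero) auto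
    then have "\<bar>t\<bar> * 1 \<le> \<bar>t\<bar> * (2 * \<bar>t\<bar>) powr (r - 1)" by (intro mult_left_mono) auto
    also have "\<dots> = 2 powr (r - 1) * \<bar>t\<bar> powr r"
      using False by (simp add: powr_mult powr_diff field_simps)
    finally have "r * \<bar>t\<bar> \<le> r * 2 powr (r - 1) * \<bar>t\<bar> powr r" using assms by simp
    moreover have "- (r * \<bar>t\<bar>) \<le> r * t" using assms by (simp add: abs_if)
    ultimately have 2: "0 \<le> r * t + r * 2 powr (r - 1) * \<bar>t\<bar> powr r" by linarith
    have "0 \<le> (C1 + C2) * t\<^sup>2" "0 \<le> C1 * \<bar>t\<bar> powr r" using C1 C2 by simp_all
    with 1 2 show ?thesis by (simp add: algebra_simps C2_def)
  qed
  moreover have "C1 + C2 \<ge> 1" using C1 C2 by simp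
  ultimately show thesis using that by blast
qed

text \<open>The preceding inequality at t = b / a, scaled by |a| powr r. The linear term is kept
  exact because its expectation vanishes when b is centered and independent of a; only the remainder
  may cost a constant. For a = 0 all terms with a factor a are 0, and C \<ge> 1 gives the
  claim.\<close>

lemma abs_add_powr_le:
  fixes r :: real
  assumes "r > 2"
  obtains C where "C \<ge> 1"
    "\<And>a b. \<bar>a + b\<bar> powr r \<le>
       \<bar>a\<bar> powr r + r * (sgn a * \<bar>a\<bar> powr (r - 1) * b) + C * (\<bar>a\<bar> powr (r - 2) * b\<^sup>2 + \<bar>b\<bar> powr r)"
proof -
  obtain C where C: "C \<ge> 1"
    "\<And>t. \<bar>1 + t\<bar> powr r \<le> 1 + r * t + C * (t\<^sup>2 + \<bar>t\<bar> powr r)"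
    using one_plus_powr_le[OF assms] by blast
  show thesis
  proof (rule that[OF C(1)])
    fix a b :: real
    show "\<bar>a + b\<bar> powr r \<le>
       \<bar>a\<bar> powr r + r * (sgn a * \<bar>a\<bar> powr (r - 1) * b) + C * (\<bar>a\<bar> powr (r - 2) * b\<^sup>2 + \<bar>b\<bar> powr r)"
    proof (cases "a = 0")
      case True
      have "1 * \<bar>b\<bar> powr r \<le> C * \<bar>b\<bar> powr r" using C(1) by (intro mult_right_mono) auto
      then show ?thesis using True assms by simp
    next
      case False
      define t where "t = b / a"
      have b: "b = a * t" using False by (simp add: t_def)
      have "\<bar>a + b\<bar> powr r = \<bar>a\<bar> powr r * \<bar>1 + t\<bar> powr r"
        unfolding powr_mult[symmetric] abs_mult[symmetric] b
        by (simp add: distrib_left)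
      also have "\<dots> \<le> \<bar>a\<bar> powr r * (1 + r * t + C * (t\<^sup>2 + \<bar>t\<bar> powr r))"
        by (intro mult_left_mono C) auto
      also have "\<dots> = \<bar>a\<bar> powr r + r * (\<bar>a\<bar> powr r * t) + C * (\<bar>a\<bar> powr r * t\<^sup>2 + \<bar>a\<bar> powr r * \<bar>t\<bar> powr r)"
        by (simp add: algebra_simps)
      also have "\<bar>a\<bar> powr r * \<bar>t\<bar> powr r = \<bar>b\<bar> powr r" by (simp add: b abs_mult powr_mult)
      also have "\<bar>a\<bar> powr r * t = sgn a * \<bar>a\<bar> powr (r - 1) * b"
        using False by (simp add: b powr_diff sgn_if)
      also have "\<bar>a\<bar> powr r * t\<^sup>2 = \<bar>a\<bar> powr (r - 2) * b\<^sup>2"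
        using False by (simp add: b powr_diff power_mult_distrib)
      finally show ?thesis .
    qed
  qed
qed

text \<open>Split (u + w) powr q as (u + w) powr (q - 1) times u + w. The part with w dominates both
  u powr (q - 1) * w and w powr q, hence their mean.\<close>

lemma powr_add_ge:
  fixes u w q :: real
  assumes "u \<ge> 0" "w \<ge> 0" "q \<ge> 1"
  shows "u powr q + (u powr (q - 1) * w + w powr q) / 2 \<le> (u + w) powr q"
proof -
  have eq: "z powr q = z powr (q - 1) * z" if "z \<ge> 0" for z :: real
    using that by (cases "z = 0") (auto simp: powr_diff)
  have 1: "u powr (q - 1) \<le> (u + w) powr (q - 1)" "w powr (q - 1) \<le> (u + w) powr (q - 1)"
    using assms by (auto intro!: powr_mono2)
  have 2: "u powr (q - 1) * u \<le> (u + w) powr (q - 1) * u" "u powr (q - 1) * w \<le> (u + w) powr (q - 1) * w"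
    "w powr (q - 1) * w \<le> (u + w) powr (q - 1) * w"
    using 1 assms by (auto intro!: mult_right_mono)
  have "u powr (q - 1) * u + (u powr (q - 1) * w + w powr (q - 1) * w) / 2
      \<le> (u + w) powr (q - 1) * u + (u + w) powr (q - 1) * w"
  proof -
    have "a + (b + c) / 2 \<le> d + e" if "a \<le> d" "b \<le> e" "c \<le> e" for a b c d e :: real
      using that by (simp add: field_simps)
    then show ?thesis using 2 by blast
  qed
  then show ?thesis using assms by (simp add: eq distrib_left)
qed

text \<open>A crude form of Young's inequality: the product is at most the r-th power of the larger
  of x and w.\<close>

lemma powr_mult_powr_le:
  fixes x w q r :: real
  assumes "x \<ge> 0" "w \<ge> 0" "0 < q" "q < r"
  shows "x powr q * w powr (r - q) \<le> x powr r + w powr r"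
proof (cases "x \<le> w")
  case True
  have "x powr q * w powr (r - q) \<le> w powr q * w powr (r - q)"
    using assms True by (intro mult_right_mono powr_mono2) auto
  then show ?thesis by (simp add: powr_add[symmetric] add_increasing)
next
  case False
  have "x powr q * w powr (r - q) \<le> x powr q * x powr (r - q)"
    using assms False by (intro mult_left_mono powr_mono2) auto
  then show ?thesis by (simp add: powr_add[symmetric] add_increasing2)
qed

section \<open>Marcinkiewicz--Zygmund bound and deviation probabilities\<close>

context prob_space begin

lemma integrable_powr_mono:
  fixes Z :: "'a \<Rightarrow> real"
  assumes [measurable]: "Z \<in> borel_measurable M"
    and "integrable M (\<lambda>\<omega>. \<bar>Z \<omega>\<bar> powr r)" "0 < q" "q \<le> r"
  shows "integrable M (\<lambda>\<omega>. \<bar>Z \<omega>\<bar> powr q)"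
proof (rule Bochner_Integration.integrable_bound)
  show "integrable M (\<lambda>\<omega>. 1 + \<bar>Z \<omega>\<bar> powr r)" using assms by simp
  have "\<bar>x\<bar> powr q \<le> 1 + \<bar>x\<bar> powr r" for x :: real
  proof (cases "\<bar>x\<bar> \<le> 1")
    case True then show ?thesis using powr_mono2[of q "\<bar>x\<bar>" 1] assms by (simp add: add_increasing2)
  next
    case False then show ?thesis using powr_mono[of q r "\<bar>x\<bar>"] assms by (simp add: add_increasing)
  qed
  then show "AE \<omega> in M. norm (\<bar>Z \<omega>\<bar> powr q) \<le> norm (1 + \<bar>Z \<omega>\<bar> powr r)" by simp
qed simp

lemma integrable_of_powr:
  fixes Z :: "'a \<Rightarrow> real"
  assumes "Z \<in> borel_measurable M" "integrable M (\<lambda>\<omega>. \<bar>Z \<omega>\<bar> powr r)" "1 \<le> r"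
  shows "integrable M Z"
  using integrable_powr_mono[OF assms(1,2), of 1] assms
  by (simp add: integrable_abs_iff)

text \<open>The factor 2 makes the pointwise bound \<open>powr_mult_powr_le\<close> sufficient, in place of Jensen's
  inequality.\<close>

lemma expectation_powr_mono:
  fixes Z :: "'a \<Rightarrow> real"
  assumes meas[measurable]: "Z \<in> borel_measurable M"
    and int: "integrable M (\<lambda>\<omega>. \<bar>Z \<omega>\<bar> powr r)" and q: "0 < q" "q < r" and "w \<ge> 0"
    and le: "expectation (\<lambda>\<omega>. \<bar>Z \<omega>\<bar> powr r) \<le> w powr r"
  shows "expectation (\<lambda>\<omega>. \<bar>Z \<omega>\<bar> powr q) \<le> 2 * w powr q"
proof (cases "w = 0")
  case True
  then have "expectation (\<lambda>\<omega>. \<bar>Z \<omega>\<bar> powr r) = 0"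
    using le by (simp add: antisym)
  then have "AE \<omega> in M. \<bar>Z \<omega>\<bar> powr r = 0"
    using integral_nonneg_eq_0_iff_AE[OF int] by simp
  then have "AE \<omega> in M. \<bar>Z \<omega>\<bar> powr q = 0" by eventually_elim simp
  then have "expectation (\<lambda>\<omega>. \<bar>Z \<omega>\<bar> powr q) = 0"
    by (subst integral_cong_AE[where g = "\<lambda>_. 0"]) auto
  then show ?thesis using True by simp
next
  case False
  have "expectation (\<lambda>\<omega>. \<bar>Z \<omega>\<bar> powr q) * w powr (r - q) =
      expectation (\<lambda>\<omega>. \<bar>Z \<omega>\<bar> powr q * w powr (r - q))" by simp
  also have "\<dots> \<le> expectation (\<lambda>\<omega>. \<bar>Z \<omega>\<bar> powr r + w powr r)"
    using integrable_powr_mono[OF meas int q(1)] q int \<open>w \<ge> 0\<close>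
    by (intro integral_mono powr_mult_powr_le) auto
  also have "\<dots> = expectation (\<lambda>\<omega>. \<bar>Z \<omega>\<bar> powr r) + w powr r"
    using int by (simp add: prob_space)
  also have "\<dots> \<le> 2 * w powr r" using le by simp
  also have "\<dots> = 2 * w powr q * w powr (r - q)" by (simp add: powr_add[symmetric])
  finally show ?thesis using False by simp
qed

text \<open>The induction adds one variable at a time: in \<open>abs_add_powr_le\<close> the term linear in \<open>b\<close> has
  expectation 0, and the term of second order is absorbed by the growth of the right-hand side, which
  \<open>powr_add_ge\<close> bounds from below.\<close>

lemma moment_sum_le:
  fixes r :: real
  assumes r: "r > 2"
  obtains K where "K \<ge> 1"
    "\<And>(I :: 'i set) Z c. finite I \<Longrightarrow> indep_vars (\<lambda>_. borel) Z I \<Longrightarrow>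
       (\<And>k. k \<in> I \<Longrightarrow> integrable M (\<lambda>\<omega>. \<bar>Z k \<omega>\<bar> powr r)) \<Longrightarrow>
       (\<And>k. k \<in> I \<Longrightarrow> expectation (Z k) = 0) \<Longrightarrow>
       (\<And>k. k \<in> I \<Longrightarrow> 0 \<le> c k \<and> expectation (\<lambda>\<omega>. \<bar>Z k \<omega>\<bar> powr r) \<le> c k powr r) \<Longrightarrow>
       integrable M (\<lambda>\<omega>. \<bar>\<Sum>k\<in>I. Z k \<omega>\<bar> powr r) \<and>
       expectation (\<lambda>\<omega>. \<bar>\<Sum>k\<in>I. Z k \<omega>\<bar> powr r) \<le> (K * sqrt (\<Sum>k\<in>I. (c k)\<^sup>2)) powr r"
proof -
  obtain C where C: "C \<ge> 1"
    "\<And>a b. \<bar>a + b\<bar> powr r \<le>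
       \<bar>a\<bar> powr r + r * (sgn a * \<bar>a\<bar> powr (r - 1) * b) + C * (\<bar>a\<bar> powr (r - 2) * b\<^sup>2 + \<bar>b\<bar> powr r)"
    using abs_add_powr_le[OF r] by blast
  \<comment> \<open>Two factors 2 from \<open>expectation_powr_mono\<close> turn the second-order
    term into 4 * C * (c i)^2 times a power of K * L. With K^2 = 8 * C this is exactly half of (K *
    c i)^2 times that power, the share that \<open>powr_add_ge\<close> leaves for it.\<close>
  define K where "K = sqrt (8 * C)"
  have K2: "K\<^sup>2 = 8 * C" and K1: "K \<ge> 1" using C(1) by (simp_all add: K_def)
  show thesis
  proof (rule that[OF K1])
    fix I :: "'i set" and Z :: "'i \<Rightarrow> 'a \<Rightarrow> real" and c :: "'i \<Rightarrow> real"
    assume "finite I" "indep_vars (\<lambda>_. borel) Z I"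
       "\<And>k. k \<in> I \<Longrightarrow> integrable M (\<lambda>\<omega>. \<bar>Z k \<omega>\<bar> powr r)"
       "\<And>k. k \<in> I \<Longrightarrow> expectation (Z k) = 0"
       "\<And>k. k \<in> I \<Longrightarrow> 0 \<le> c k \<and> expectation (\<lambda>\<omega>. \<bar>Z k \<omega>\<bar> powr r) \<le> c k powr r"
    then show "integrable M (\<lambda>\<omega>. \<bar>\<Sum>k\<in>I. Z k \<omega>\<bar> powr r) \<and>
       expectation (\<lambda>\<omega>. \<bar>\<Sum>k\<in>I. Z k \<omega>\<bar> powr r) \<le> (K * sqrt (\<Sum>k\<in>I. (c k)\<^sup>2)) powr r"
    proof (induction I)
      case empty
      then show ?case using r by simp
    next
      case (insert i I)
      define S where "S \<omega> = (\<Sum>k\<in>I. Z k \<omega>)" for \<omega>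
      define L where "L = sqrt (\<Sum>k\<in>I. (c k)\<^sup>2)"
      have indepI: "indep_vars (\<lambda>_. borel) Z I"
        using insert.prems(1) by (rule indep_vars_subset) auto
      have rv[measurable]: "Z k \<in> borel_measurable M" if "k \<in> insert i I" for k
        using insert.prems(1) that by (auto simp: indep_vars_def2)
      have Zi[measurable]: "Z i \<in> borel_measurable M" by (rule rv) simp
      have S[measurable]: "S \<in> borel_measurable M"
        unfolding S_def[abs_def] using rv by (intro borel_measurable_sum) auto
      have IH: "integrable M (\<lambda>\<omega>. \<bar>S \<omega>\<bar> powr r)" "expectation (\<lambda>\<omega>. \<bar>S \<omega>\<bar> powr r) \<le> (K * L) powr r"
        using insert.IH[OF indepI] insert.prems by (auto simp: S_def L_def)
      have intZr: "integrable M (\<lambda>\<omega>. \<bar>Z i \<omega>\<bar> powr r)" and EZ: "expectation (Z i) = 0"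
        and ci: "0 \<le> c i" and Zr: "expectation (\<lambda>\<omega>. \<bar>Z i \<omega>\<bar> powr r) \<le> c i powr r"
        using insert.prems by auto
      have ind: "indep_var borel (Z i) borel S"
        unfolding S_def[abs_def] using insert.hyps insert.prems(1) by (intro indep_vars_sum) auto
      have intZ: "integrable M (Z i)"
        using integrable_of_powr[OF Zi intZr] r by simp
      have intZ2: "integrable M (\<lambda>\<omega>. (Z i \<omega>)\<^sup>2)"
        using integrable_powr_mono[OF Zi intZr, of 2] r by simp
      have intS2: "integrable M (\<lambda>\<omega>. \<bar>S \<omega>\<bar> powr (r - 2))"
        using integrable_powr_mono[OF S IH(1), of "r - 2"] r by simp
      have intS1: "integrable M (\<lambda>\<omega>. sgn (S \<omega>) * \<bar>S \<omega>\<bar> powr (r - 1))"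
        by (rule Bochner_Integration.integrable_bound[OF integrable_powr_mono[OF S IH(1), of "r - 1"]])
           (use r in \<open>auto simp: abs_mult abs_sgn_eq\<close>)
      have ind1: "indep_var borel (Z i) borel (\<lambda>\<omega>. sgn (S \<omega>) * \<bar>S \<omega>\<bar> powr (r - 1))"
        using indep_var_compose[OF ind, of id borel "\<lambda>s. sgn s * \<bar>s\<bar> powr (r - 1)" borel]
        by (simp add: comp_def)
      have ind2: "indep_var borel (\<lambda>\<omega>. (Z i \<omega>)\<^sup>2) borel (\<lambda>\<omega>. \<bar>S \<omega>\<bar> powr (r - 2))"
        using indep_var_compose[OF ind, of "\<lambda>x. x\<^sup>2" borel "\<lambda>s. \<bar>s\<bar> powr (r - 2)" borel]
        by (simp add: comp_def)
      have E1: "expectation (\<lambda>\<omega>. sgn (S \<omega>) * \<bar>S \<omega>\<bar> powr (r - 1) * Z i \<omega>) = 0"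
        using indep_var_lebesgue_integral[OF ind1 intZ intS1] EZ by (simp add: ac_simps)
      have int1: "integrable M (\<lambda>\<omega>. sgn (S \<omega>) * \<bar>S \<omega>\<bar> powr (r - 1) * Z i \<omega>)"
        using indep_var_integrable[OF ind1 intZ intS1] by (simp add: ac_simps)
      have E2: "expectation (\<lambda>\<omega>. \<bar>S \<omega>\<bar> powr (r - 2) * (Z i \<omega>)\<^sup>2) =
          expectation (\<lambda>\<omega>. \<bar>S \<omega>\<bar> powr (r - 2)) * expectation (\<lambda>\<omega>. (Z i \<omega>)\<^sup>2)"
        using indep_var_lebesgue_integral[OF ind2 intZ2 intS2] by (simp add: ac_simps)
      have int2: "integrable M (\<lambda>\<omega>. \<bar>S \<omega>\<bar> powr (r - 2) * (Z i \<omega>)\<^sup>2)"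
        using indep_var_integrable[OF ind2 intZ2 intS2] by (simp add: ac_simps)
      have int3: "integrable M (\<lambda>\<omega>. \<bar>S \<omega>\<bar> powr r + r * (sgn (S \<omega>) * \<bar>S \<omega>\<bar> powr (r - 1) * Z i \<omega>)
          + C * (\<bar>S \<omega>\<bar> powr (r - 2) * (Z i \<omega>)\<^sup>2 + \<bar>Z i \<omega>\<bar> powr r))"
        using IH(1) int1 int2 intZr by simp
      have int4: "integrable M (\<lambda>\<omega>. \<bar>S \<omega> + Z i \<omega>\<bar> powr r)"
        by (rule Bochner_Integration.integrable_bound[OF int3])
           (auto intro!: AE_I2 order_trans[OF C(2)])
      have "expectation (\<lambda>\<omega>. \<bar>S \<omega> + Z i \<omega>\<bar> powr r) \<le>
         expectation (\<lambda>\<omega>. \<bar>S \<omega>\<bar> powr r + r * (sgn (S \<omega>) * \<bar>S \<omega>\<bar> powr (r - 1) * Z i \<omega>)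
          + C * (\<bar>S \<omega>\<bar> powr (r - 2) * (Z i \<omega>)\<^sup>2 + \<bar>Z i \<omega>\<bar> powr r))"
        by (rule integral_mono[OF int4 int3]) (rule C(2))
      also have "\<dots> = expectation (\<lambda>\<omega>. \<bar>S \<omega>\<bar> powr r) + C * (expectation (\<lambda>\<omega>. \<bar>S \<omega>\<bar> powr (r - 2)) *
           expectation (\<lambda>\<omega>. (Z i \<omega>)\<^sup>2) + expectation (\<lambda>\<omega>. \<bar>Z i \<omega>\<bar> powr r))"
        using IH(1) int1 int2 intZr E1 E2 by simp
      also have "\<dots> \<le> (K * L) powr r + C * ((2 * (K * L) powr (r - 2)) * (2 * (c i)\<^sup>2) + c i powr r)"
      proof (intro add_mono mult_left_mono mult_mono)
        have "L \<ge> 0" by (simp add: L_def sum_nonneg)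
        then show "expectation (\<lambda>\<omega>. \<bar>S \<omega>\<bar> powr (r - 2)) \<le> 2 * (K * L) powr (r - 2)"
          using expectation_powr_mono[OF S IH(1) _ _ _ IH(2), of "r - 2"] r K1 by simp
        show "expectation (\<lambda>\<omega>. (Z i \<omega>)\<^sup>2) \<le> 2 * (c i)\<^sup>2"
          using expectation_powr_mono[OF Zi intZr _ _ ci Zr, of 2] r ci by simp
      qed (use IH Zr C(1) in auto)
      \<comment> \<open>The scales add up in squares, so the growth is measured in the variables (K
        * L)^2 and (K * c i)^2, with the exponent r / 2 > 1.\<close>
      also have "\<dots> \<le> ((K * L)\<^sup>2 + (K * c i)\<^sup>2) powr (r / 2)"
      proof -
        have sq: "x powr (2 * q) = x\<^sup>2 powr q" if "x \<ge> 0" for x q :: real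
          using that by (cases "x = 0") (auto simp: powr_powr[symmetric])
        have L0: "K * L \<ge> 0" using K1 by (simp add: L_def sum_nonneg)
        have c0: "K * c i \<ge> 0" using K1 ci by simp
        have "C * c i powr r \<le> (K * c i) powr r / 2"
        proof -
          have "2 * C \<le> K\<^sup>2" using C(1) K2 by simp
          also have "K\<^sup>2 = K powr 2" using K1 by simp
          also have "\<dots> \<le> K powr r" using K1 r by (intro powr_mono) auto
          finally have "2 * C * c i powr r \<le> K powr r * c i powr r" by (intro mult_right_mono) auto
          then show ?thesis by (simp add: powr_mult)
        qed
        moreover have "C * (2 * (K * L) powr (r - 2) * (2 * (c i)\<^sup>2)) = ((K * L) powr (r - 2) * (K * c i)\<^sup>2) / 2"
          by (simp add: power_mult_distrib K2)
        ultimately have "(K * L) powr r + C * ((2 * (K * L) powr (r - 2)) * (2 * (c i)\<^sup>2) + c i powr r) \<le>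
          (K * L) powr r + ((K * L) powr (r - 2) * (K * c i)\<^sup>2 + (K * c i) powr r) / 2"
          unfolding distrib_left add_divide_distrib by linarith
        also have "\<dots> = (K * L)\<^sup>2 powr (r/2) + ((K * L)\<^sup>2 powr (r/2 - 1) * (K * c i)\<^sup>2 + (K * c i)\<^sup>2 powr (r/2)) / 2"
          using sq[OF L0, of "r/2"] sq[OF L0, of "r/2 - 1"] sq[OF c0, of "r/2"]
          by (simp add: right_diff_distrib)
        also have "\<dots> \<le> ((K * L)\<^sup>2 + (K * c i)\<^sup>2) powr (r / 2)"
          using r by (intro powr_add_ge) auto
        finally show ?thesis .
      qed
      also have "(K * L)\<^sup>2 + (K * c i)\<^sup>2 = (K * sqrt (\<Sum>k\<in>insert i I. (c k)\<^sup>2))\<^sup>2"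
        using insert.hyps by (simp add: power_mult_distrib L_def sum_nonneg distrib_left add.commute)
      also have "\<dots> powr (r / 2) = (K * sqrt (\<Sum>k\<in>insert i I. (c k)\<^sup>2)) powr r"
      proof -
        have "0 \<le> K * sqrt (\<Sum>k\<in>insert i I. (c k)\<^sup>2)" using K1 by (simp add: sum_nonneg)
        then have "(K * sqrt (\<Sum>k\<in>insert i I. (c k)\<^sup>2))\<^sup>2 = (K * sqrt (\<Sum>k\<in>insert i I. (c k)\<^sup>2)) powr 2"
          by (simp del: sum.insert)
        then show ?thesis by (simp only: powr_powr) simp
      qed
      finally have "expectation (\<lambda>\<omega>. \<bar>S \<omega> + Z i \<omega>\<bar> powr r) \<le>
         (K * sqrt (\<Sum>k\<in>insert i I. (c k)\<^sup>2)) powr r" .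
      moreover have "(\<Sum>k\<in>insert i I. Z k \<omega>) = S \<omega> + Z i \<omega>" for \<omega>
        using insert.hyps by (simp add: S_def add.commute)
      ultimately show ?case using int4 by simp
    qed
  qed
qed

lemma prob_gt_le_moment:
  fixes Z :: "'a \<Rightarrow> real"
  assumes [measurable]: "Z \<in> borel_measurable M"
    and int: "integrable M (\<lambda>\<omega>. \<bar>Z \<omega>\<bar> powr r)" and "0 < t" "0 < r"
    and le: "expectation (\<lambda>\<omega>. \<bar>Z \<omega>\<bar> powr r) \<le> w powr r"
  shows "prob {\<omega> \<in> space M. t < \<bar>Z \<omega>\<bar>} \<le> (w / t) powr r"
proof -
  have "prob {\<omega> \<in> space M. t < \<bar>Z \<omega>\<bar>} \<le> prob {\<omega> \<in> space M. t powr r \<le> \<bar>Z \<omega>\<bar> powr r}"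
    using assms by (intro finite_measure_mono) (auto intro!: powr_mono2)
  also have "\<dots> \<le> expectation (\<lambda>\<omega>. \<bar>Z \<omega>\<bar> powr r) / t powr r"
    using integral_Markov_inequality_measure[OF int, of "{}" "t powr r"] \<open>0 < t\<close> by simp
  also have "\<dots> \<le> w powr r / t powr r"
    using le \<open>0 < t\<close> by (intro divide_right_mono) auto
  also have "\<dots> = (w / t) powr r" by (simp add: powr_divide)
  finally show ?thesis .
qed

text \<open>The k-th summand has scale |x k| * m, where m bounds the r-norm of the law; in squares
  these scales add up to m^2 times the squared norm of x. So D depends on neither x nor the number
  of variables.\<close>

lemma linear_form_moment_le:
  fixes r :: real and \<mu> :: "real measure"
  assumes r: "r > 2" and \<mu>: "real_distribution \<mu>"
    and int: "integrable \<mu> (\<lambda>x. \<bar>x\<bar> powr r)" and mean: "(\<integral>x. x \<partial>\<mu>) = 0"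
  obtains D where "D > 0"
    "\<And>(I :: 'i set) X x. finite I \<Longrightarrow> indep_vars (\<lambda>_. borel) X I \<Longrightarrow>
       (\<And>k. k \<in> I \<Longrightarrow> distr M borel (X k) = \<mu>) \<Longrightarrow>
       integrable M (\<lambda>\<omega>. \<bar>\<Sum>k\<in>I. x k * X k \<omega>\<bar> powr r) \<and>
       expectation (\<lambda>\<omega>. \<bar>\<Sum>k\<in>I. x k * X k \<omega>\<bar> powr r) \<le> (D * sqrt (\<Sum>k\<in>I. (x k)\<^sup>2)) powr r"
proof -
  interpret \<mu>: real_distribution \<mu> by fact
  obtain K where K: "K \<ge> 1" 
    "\<And>(I :: 'i set) Z c. finite I \<Longrightarrow> indep_vars (\<lambda>_. borel) Z I \<Longrightarrow>
       (\<And>k. k \<in> I \<Longrightarrow> integrable M (\<lambda>\<omega>. \<bar>Z k \<omega>\<bar> powr r)) \<Longrightarrow>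
       (\<And>k. k \<in> I \<Longrightarrow> expectation (Z k) = 0) \<Longrightarrow>
       (\<And>k. k \<in> I \<Longrightarrow> 0 \<le> c k \<and> expectation (\<lambda>\<omega>. \<bar>Z k \<omega>\<bar> powr r) \<le> c k powr r) \<Longrightarrow>
       integrable M (\<lambda>\<omega>. \<bar>\<Sum>k\<in>I. Z k \<omega>\<bar> powr r) \<and>
       expectation (\<lambda>\<omega>. \<bar>\<Sum>k\<in>I. Z k \<omega>\<bar> powr r) \<le> (K * sqrt (\<Sum>k\<in>I. (c k)\<^sup>2)) powr r"
    using moment_sum_le[OF r] by blast
  \<comment> \<open>The summand 1 makes m, and with it D, positive without an argument that the law
    is nondegenerate.\<close>
  define m where "m = 1 + (\<integral>x. \<bar>x\<bar> powr r \<partial>\<mu>) powr (1 / r)"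
  have m: "m > 0" by (simp add: m_def add_pos_nonneg)
  have mr: "(\<integral>x. \<bar>x\<bar> powr r \<partial>\<mu>) \<le> m powr r"
  proof -
    have "(\<integral>x. \<bar>x\<bar> powr r \<partial>\<mu>) = ((\<integral>x. \<bar>x\<bar> powr r \<partial>\<mu>) powr (1 / r)) powr r"
      using r by (simp add: powr_powr)
    also have "\<dots> \<le> m powr r" using r by (intro powr_mono2) (auto simp: m_def)
    finally show ?thesis .
  qed
  show thesis
  proof (rule that[of "K * m"])
    fix I :: "'i set" and X x
    assume fin: "finite I" and ind: "indep_vars (\<lambda>_. borel) X I"
      and d: "\<And>k. k \<in> I \<Longrightarrow> distr M borel (X k) = \<mu>"
    have rv[measurable]: "X k \<in> borel_measurable M" if "k \<in> I" for k
      using ind that by (auto simp: indep_vars_def2)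
    have intX: "integrable M (\<lambda>\<omega>. \<bar>X k \<omega>\<bar> powr r)"
      and EX: "expectation (\<lambda>\<omega>. \<bar>X k \<omega>\<bar> powr r) = (\<integral>x. \<bar>x\<bar> powr r \<partial>\<mu>)"
      and EX0: "expectation (X k) = 0" if "k \<in> I" for k
      using int mean rv[OF that]
      by (simp_all add: d[OF that, symmetric] integrable_distr_eq integral_distr)
    have "integrable M (\<lambda>\<omega>. \<bar>\<Sum>k\<in>I. x k * X k \<omega>\<bar> powr r) \<and>
       expectation (\<lambda>\<omega>. \<bar>\<Sum>k\<in>I. x k * X k \<omega>\<bar> powr r) \<le> (K * sqrt (\<Sum>k\<in>I. (\<bar>x k\<bar> * m)\<^sup>2)) powr r"
    proof (rule K(2))
      show "indep_vars (\<lambda>_. borel) (\<lambda>k \<omega>. x k * X k \<omega>) I"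
        using ind by (rule indep_vars_compose2) simp
      fix k assume k: "k \<in> I"
      show "integrable M (\<lambda>\<omega>. \<bar>x k * X k \<omega>\<bar> powr r)"
        using intX[OF k] by (simp add: abs_mult powr_mult)
      show "expectation (\<lambda>\<omega>. x k * X k \<omega>) = 0" using EX0[OF k] by simp
      show "0 \<le> \<bar>x k\<bar> * m \<and> expectation (\<lambda>\<omega>. \<bar>x k * X k \<omega>\<bar> powr r) \<le> (\<bar>x k\<bar> * m) powr r"
        using EX[OF k] m mr by (simp add: abs_mult powr_mult mult_left_mono)
    qed fact
    moreover have "K * sqrt (\<Sum>k\<in>I. (\<bar>x k\<bar> * m)\<^sup>2) = K * m * sqrt (\<Sum>k\<in>I. (x k)\<^sup>2)"
      using m by (simp add: power_mult_distrib sum_distrib_right[symmetric] real_sqrt_mult)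
    ultimately show "integrable M (\<lambda>\<omega>. \<bar>\<Sum>k\<in>I. x k * X k \<omega>\<bar> powr r) \<and>
       expectation (\<lambda>\<omega>. \<bar>\<Sum>k\<in>I. x k * X k \<omega>\<bar> powr r) \<le> (K * m * sqrt (\<Sum>k\<in>I. (x k)\<^sup>2)) powr r"
      by simp
  qed (use K(1) m in simp)
qed

text \<open>The centered sum has scale sqrt n * s, against a threshold of order n * s; the r-th
  power of the quotient gives the rate. The scale s will be the squared norm of the row vector for
  sums of squares, and its norm for sums of absolute values.\<close>

lemma prob_sum_deviation_le:
  fixes r D \<epsilon> :: real
  assumes r: "r > 2" and D: "D > 0" and \<epsilon>: "\<epsilon> > 0"
  obtains L where "L \<ge> 0"
    "\<And>(J :: 'i set) (Y :: 'i \<Rightarrow> 'a \<Rightarrow> real) (s :: real). finite J \<Longrightarrow> J \<noteq> {} \<Longrightarrow> indep_vars (\<lambda>_. borel) Y J \<Longrightarrow> s > 0 \<Longrightarrow>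
       (\<And>j. j \<in> J \<Longrightarrow> integrable M (\<lambda>\<omega>. \<bar>Y j \<omega>\<bar> powr r)) \<Longrightarrow>
       (\<And>j. j \<in> J \<Longrightarrow> expectation (\<lambda>\<omega>. \<bar>Y j \<omega>\<bar> powr r) \<le> (D * s) powr r) \<Longrightarrow>
       prob {\<omega> \<in> space M. \<epsilon> * (card J * s) < \<bar>(\<Sum>j\<in>J. Y j \<omega>) - (\<Sum>j\<in>J. expectation (Y j))\<bar>} \<le> L * card J powr (- r / 2)"
proof -
  obtain K where K: "K \<ge> 1" 
    "\<And>(I :: 'i set) Z c. finite I \<Longrightarrow> indep_vars (\<lambda>_. borel) Z I \<Longrightarrow>
       (\<And>k. k \<in> I \<Longrightarrow> integrable M (\<lambda>\<omega>. \<bar>Z k \<omega>\<bar> powr r)) \<Longrightarrow>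
       (\<And>k. k \<in> I \<Longrightarrow> expectation (Z k) = 0) \<Longrightarrow>
       (\<And>k. k \<in> I \<Longrightarrow> 0 \<le> c k \<and> expectation (\<lambda>\<omega>. \<bar>Z k \<omega>\<bar> powr r) \<le> c k powr r) \<Longrightarrow>
       integrable M (\<lambda>\<omega>. \<bar>\<Sum>k\<in>I. Z k \<omega>\<bar> powr r) \<and>
       expectation (\<lambda>\<omega>. \<bar>\<Sum>k\<in>I. Z k \<omega>\<bar> powr r) \<le> (K * sqrt (\<Sum>k\<in>I. (c k)\<^sup>2)) powr r"
    using moment_sum_le[OF r] by blast
  show thesis
  \<comment> \<open>The 8 is made of three factors 2: the mean is at most 2 * (D * s), the distance
    of y from it is at most twice the larger of |y| and 2 * (D * s), and adding the two r-th powers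
    costs at most 2 powr r.\<close>
  proof (rule that[of "(K * 8 * D / \<epsilon>) powr r"])
    fix J :: "'i set" and Y :: "'i \<Rightarrow> 'a \<Rightarrow> real" and s :: real
    assume fin: "finite J" and ne: "J \<noteq> {}" and ind: "indep_vars (\<lambda>_. borel) Y J" and s: "s > 0"
      and int: "\<And>j. j \<in> J \<Longrightarrow> integrable M (\<lambda>\<omega>. \<bar>Y j \<omega>\<bar> powr r)"
      and le: "\<And>j. j \<in> J \<Longrightarrow> expectation (\<lambda>\<omega>. \<bar>Y j \<omega>\<bar> powr r) \<le> (D * s) powr r"
    define n where "n = real (card J)"
    have n: "n > 0" using fin ne by (simp add: n_def card_gt_0_iff)
    have rv[measurable]: "Y j \<in> borel_measurable M" if "j \<in> J" for j
      using ind that by (auto simp: indep_vars_def2)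
    have intY: "integrable M (Y j)" if "j \<in> J" for j
      using integrable_of_powr[OF rv[OF that] int[OF that]] r by simp
    define m where "m j = expectation (Y j)" for j
    have m: "\<bar>m j\<bar> \<le> 2 * (D * s)" if j: "j \<in> J" for j
    proof -
      have "\<bar>m j\<bar> \<le> expectation (\<lambda>\<omega>. \<bar>Y j \<omega>\<bar> powr 1)"
        using m_def[of j] integral_abs_bound[of M "Y j"] by simp
      also have "\<dots> \<le> 2 * (D * s) powr 1"
        using r D s le[OF j] by (intro expectation_powr_mono[OF rv[OF j] int[OF j]]) auto
      finally show ?thesis using D s by simp
    qed
    have pw: "\<bar>y - m j\<bar> powr r \<le> 2 powr r * (\<bar>y\<bar> powr r + (2 * (D * s)) powr r)"
      if "j \<in> J" for y j
    proof -
      have "\<bar>y - m j\<bar> powr r \<le> (2 * max \<bar>y\<bar> (2 * (D * s))) powr r"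
        using m[OF that] r by (intro powr_mono2) auto
      also have "\<dots> = 2 powr r * max \<bar>y\<bar> (2 * (D * s)) powr r"
        using D s by (intro powr_mult)
      also have "max \<bar>y\<bar> (2 * (D * s)) powr r \<le> \<bar>y\<bar> powr r + (2 * (D * s)) powr r"
        by (simp add: max_def)
      finally show ?thesis by simp
    qed
    have intb: "integrable M (\<lambda>\<omega>. 2 powr r * (\<bar>Y j \<omega>\<bar> powr r + (2 * (D * s)) powr r))"
      if "j \<in> J" for j using int[OF that] by simp
    have intZ: "integrable M (\<lambda>\<omega>. \<bar>Y j \<omega> - m j\<bar> powr r)" if "j \<in> J" for j
    proof (rule Bochner_Integration.integrable_bound[OF intb[OF that]])
      show "(\<lambda>\<omega>. \<bar>Y j \<omega> - m j\<bar> powr r) \<in> borel_measurable M" using rv[OF that] by measurable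
    qed (use pw[OF that] in simp)
    have Z: "expectation (\<lambda>\<omega>. \<bar>Y j \<omega> - m j\<bar> powr r) \<le> (8 * D * s) powr r" if "j \<in> J" for j
    proof -
      have "expectation (\<lambda>\<omega>. \<bar>Y j \<omega> - m j\<bar> powr r) \<le>
          expectation (\<lambda>\<omega>. 2 powr r * (\<bar>Y j \<omega>\<bar> powr r + (2 * (D * s)) powr r))"
        by (rule integral_mono[OF intZ[OF that] intb[OF that] pw[OF that]])
      also have "\<dots> = 2 powr r * (expectation (\<lambda>\<omega>. \<bar>Y j \<omega>\<bar> powr r) + (2 * (D * s)) powr r)"
        using int[OF that] by (simp add: prob_space)
      also have "\<dots> \<le> 2 powr r * ((D * s) powr r + (2 * (D * s)) powr r)"
        using le[OF that] by simp
      also have "\<dots> \<le> 2 powr r * ((2 * (D * s)) powr r + (2 * (D * s)) powr r)"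
        using D s r by (intro mult_left_mono add_right_mono powr_mono2) auto
      also have "\<dots> = 2 powr r * (2 powr 1 * (2 * (D * s)) powr r)" by simp
      also have "\<dots> \<le> 2 powr r * (2 powr r * (2 * (D * s)) powr r)"
        using r by (intro mult_left_mono mult_right_mono powr_mono) auto
      also have "\<dots> = (2 * (2 * (2 * (D * s)))) powr r" by (simp only: powr_mult)
      finally show ?thesis by (simp add: mult.assoc)
    qed
    have sum: "integrable M (\<lambda>\<omega>. \<bar>\<Sum>j\<in>J. Y j \<omega> - m j\<bar> powr r) \<and>
       expectation (\<lambda>\<omega>. \<bar>\<Sum>j\<in>J. Y j \<omega> - m j\<bar> powr r) \<le> (K * sqrt (\<Sum>j\<in>J. (8 * D * s)\<^sup>2)) powr r"
    proof (rule K(2))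
      show "indep_vars (\<lambda>_. borel) (\<lambda>j \<omega>. Y j \<omega> - m j) J"
        using ind by (rule indep_vars_compose2) simp
    qed (use fin intZ Z intY m_def D s in \<open>auto simp: prob_space\<close>)
    have "prob {\<omega> \<in> space M. \<epsilon> * (n * s) < \<bar>\<Sum>j\<in>J. Y j \<omega> - m j\<bar>} \<le>
      (K * sqrt (\<Sum>j\<in>J. (8 * D * s)\<^sup>2) / (\<epsilon> * (n * s))) powr r"
      using sum r \<epsilon> n s by (intro prob_gt_le_moment) auto
    also have "K * sqrt (\<Sum>j\<in>J. (8 * D * s)\<^sup>2) / (\<epsilon> * (n * s)) = K * 8 * D / \<epsilon> * n powr (- 1 / 2)"
    proof -
      have a: "sqrt (\<Sum>j\<in>J. (8 * D * s)\<^sup>2) = sqrt n * (8 * D * s)"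
        using D s by (simp add: n_def real_sqrt_mult)
      have b: "n powr (- 1 / 2) = sqrt n / n"
        using n powr_diff[of n "1/2" 1] by (simp add: powr_half_sqrt)
      show ?thesis unfolding a b using s by simp
    qed
    also have "\<dots> powr r = (K * 8 * D / \<epsilon>) powr r * n powr (- r / 2)"
      unfolding powr_mult[of "K * 8 * D / \<epsilon>"] powr_powr by simp
    finally show "prob {\<omega> \<in> space M. \<epsilon> * (card J * s) < \<bar>(\<Sum>j\<in>J. Y j \<omega>) - (\<Sum>j\<in>J. expectation (Y j))\<bar>} \<le>
        (K * 8 * D / \<epsilon>) powr r * card J powr (- r / 2)"
      by (simp add: sum_subtractf n_def m_def)
  qed simp
qed

end

section \<open>First absolute moments of linear forms\<close>

lemma centered_unit_variance_lawD:
  assumes "centered_unit_variance_law \<mu>"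
  shows "real_distribution \<mu>" "integrable \<mu> (\<lambda>x. x)" "integrable \<mu> (\<lambda>x. x\<^sup>2)"
    "(\<integral>x. x \<partial>\<mu>) = 0" "prob_space.variance \<mu> (\<lambda>x. x) = 1" "(\<integral>x. x\<^sup>2 \<partial>\<mu>) = 1"
proof -
  note * = assms[unfolded centered_unit_variance_law_def]
  from * show "real_distribution \<mu>" "integrable \<mu> (\<lambda>x. x)" "integrable \<mu> (\<lambda>x. x\<^sup>2)"
    "(\<integral>x. x \<partial>\<mu>) = 0" "prob_space.variance \<mu> (\<lambda>x. x) = 1" by blast+
  from this(4,5) show "(\<integral>x. x\<^sup>2 \<partial>\<mu>) = 1" by simp
qed

text \<open>An identity and not just a bound, since it fixes the value at which the squared norms
  concentrate. The mixed terms vanish by independence and centering.\<close>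

lemma (in prob_space) linear_form_second_moment:
  fixes X :: "'i \<Rightarrow> 'a \<Rightarrow> real"
  assumes \<mu>: "centered_unit_variance_law \<mu>"
    and fin: "finite I" and ind: "indep_vars (\<lambda>_. borel) X I"
    and d: "\<And>k. k \<in> I \<Longrightarrow> distr M borel (X k) = \<mu>"
  shows "integrable M (\<lambda>\<omega>. (\<Sum>k\<in>I. x k * X k \<omega>)\<^sup>2) \<and>
    expectation (\<lambda>\<omega>. \<Sum>k\<in>I. x k * X k \<omega>) = 0 \<and>
    expectation (\<lambda>\<omega>. (\<Sum>k\<in>I. x k * X k \<omega>)\<^sup>2) = (\<Sum>k\<in>I. (x k)\<^sup>2)"
  using fin ind d
proof (induction I)
  case (insert i I)
  interpret \<mu>: real_distribution \<mu> by (rule centered_unit_variance_lawD(1)[OF \<mu>])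
  define S where "S \<omega> = (\<Sum>k\<in>I. x k * X k \<omega>)" for \<omega>
  have indepI: "indep_vars (\<lambda>_. borel) X I"
    using insert.prems(1) by (rule indep_vars_subset) auto
  have rv[measurable]: "X k \<in> borel_measurable M" if "k \<in> insert i I" for k
    using insert.prems(1) that by (auto simp: indep_vars_def2)
  have Xi[measurable]: "X i \<in> borel_measurable M" by (rule rv) simp
  have S[measurable]: "S \<in> borel_measurable M"
    unfolding S_def[abs_def] using rv by (intro borel_measurable_sum borel_measurable_times) auto
  have di: "distr M borel (X i) = \<mu>" using insert.prems by simp
  have Ei: "integrable M (X i)" "integrable M (\<lambda>\<omega>. (X i \<omega>)\<^sup>2)" "expectation (X i) = 0"
      "expectation (\<lambda>\<omega>. (X i \<omega>)\<^sup>2) = 1"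
    using centered_unit_variance_lawD(2,3,4,6)[OF \<mu>] unfolding di[symmetric]
    by (simp_all add: integrable_distr_eq integral_distr)
  have IH: "integrable M (\<lambda>\<omega>. (S \<omega>)\<^sup>2)" "expectation S = 0"
    "expectation (\<lambda>\<omega>. (S \<omega>)\<^sup>2) = (\<Sum>k\<in>I. (x k)\<^sup>2)"
    using insert.IH[OF indepI] insert.prems by (auto simp: S_def[abs_def])
  have intS: "integrable M S" by (rule square_integrable_imp_integrable[OF S IH(1)])
  have ind: "indep_var borel (\<lambda>\<omega>. x i * X i \<omega>) borel S"
    unfolding S_def[abs_def] using insert.hyps
    by (intro indep_vars_sum indep_vars_compose2[OF insert.prems(1)]) auto
  have intx: "integrable M (\<lambda>\<omega>. x i * X i \<omega>)" using Ei by simp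
  note int1 = indep_var_integrable[OF ind intx intS]
  have E1: "expectation (\<lambda>\<omega>. x i * X i \<omega> * S \<omega>) = 0"
    using indep_var_lebesgue_integral[OF ind intx intS] IH by simp
  have eq: "(\<Sum>k\<in>insert i I. x k * X k \<omega>) = x i * X i \<omega> + S \<omega>" for \<omega>
    using insert.hyps by (simp add: S_def)
  have eq2: "(x i * X i \<omega> + S \<omega>)\<^sup>2 = (x i)\<^sup>2 * (X i \<omega>)\<^sup>2 + 2 * (x i * X i \<omega> * S \<omega>) + (S \<omega>)\<^sup>2" for \<omega>
    by (simp add: power2_sum power_mult_distrib)
  show ?case
    unfolding eq eq2 using insert.hyps IH Ei int1 E1 intS intx by simp
qed simp

section \<open>Central limit theorem for weighted sums\<close>

text \<open>For v = u^2 / 2 this compares the second-order expansion of a characteristic function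
  with the Gaussian one. Both sides rest on 1 + y \<le> exp y, the upper bound through the sign of
  the derivative.\<close>

lemma exp_minus_diff_le:
  fixes v :: real
  assumes "v \<ge> 0"
  shows "\<bar>1 - v - exp (- v)\<bar> \<le> v\<^sup>2 / 2"
proof -
  have 1: "1 - v \<le> exp (- v)" using exp_ge_add_one_self[of "- v"] by simp
  have "exp (- v) \<le> 1 - v + v\<^sup>2 / 2"
  proof -
    have der: "((\<lambda>v. 1 - v + v\<^sup>2 / 2 - exp (- v)) has_real_derivative - 1 + u + exp (- u)) (at u)" for u :: real
      by (auto intro!: derivative_eq_intros)
    have "(\<lambda>v. 1 - v + v\<^sup>2 / 2 - exp (- v)) (0::real) \<le> 1 - v + v\<^sup>2 / 2 - exp (- v)"
    proof (rule DERIV_nonneg_imp_nondecreasing[OF assms])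
      fix u :: real
      have "0 \<le> - 1 + u + exp (- u)" using exp_ge_add_one_self[of "- u"] by simp
      then show "\<exists>y. ((\<lambda>v. 1 - v + v\<^sup>2 / 2 - exp (- v)) has_real_derivative y) (at u) \<and> 0 \<le> y"
        using der by blast
    qed
    then show ?thesis by simp
  qed
  then show ?thesis using 1 by simp
qed

text \<open>Truncation changes nothing where |x| \<le> K, and elsewhere at most |x| \<le> x^2 / K.
  The error involves the law only through its second moment, which provides the uniform
  integrability needed next.\<close>

lemma (in real_distribution) expectation_abs_truncate:
  assumes int: "integrable M (\<lambda>x. x\<^sup>2)" and "K > 0"
  shows "\<bar>expectation (\<lambda>x. \<bar>x\<bar>) - expectation (\<lambda>x. min \<bar>x\<bar> K)\<bar> \<le> expectation (\<lambda>x. x\<^sup>2) / K"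
proof -
  have int1: "integrable M (\<lambda>x. \<bar>x\<bar>)"
    using square_integrable_imp_integrable[OF _ int] by simp
  have int2: "integrable M (\<lambda>x. min \<bar>x\<bar> K)"
    by (rule Bochner_Integration.integrable_bound[OF int1]) (use \<open>K > 0\<close> in auto)
  have "\<bar>expectation (\<lambda>x. \<bar>x\<bar>) - expectation (\<lambda>x. min \<bar>x\<bar> K)\<bar> = \<bar>expectation (\<lambda>x. \<bar>x\<bar> - min \<bar>x\<bar> K)\<bar>"
    using int1 int2 by simp
  also have "\<dots> \<le> expectation (\<lambda>x. \<bar>\<bar>x\<bar> - min \<bar>x\<bar> K\<bar>)" by (rule integral_abs_bound)
  also have "\<dots> \<le> expectation (\<lambda>x. x\<^sup>2 / K)"
  proof (rule integral_mono)
    fix x :: real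
    show "\<bar>\<bar>x\<bar> - min \<bar>x\<bar> K\<bar> \<le> x\<^sup>2 / K"
    proof (cases "\<bar>x\<bar> \<le> K")
      case False
      have "\<bar>x\<bar> * K \<le> \<bar>x\<bar> * \<bar>x\<bar>" using False by (intro mult_left_mono) auto
      then have "\<bar>x\<bar> \<le> x\<^sup>2 / K" using \<open>K > 0\<close> by (simp add: field_simps power2_eq_square)
      then show ?thesis using False \<open>K > 0\<close> by simp
    qed (use \<open>K > 0\<close> in simp)
  qed (use int int1 int2 in auto)
  finally show ?thesis by simp
qed

text \<open>Weak convergence speaks of bounded continuous functions only. The common second moment 1
  keeps the truncation error below 1 / K for all laws at once, and K = 3 / e leaves a third of e for
  the limit of the truncated integrals.\<close>

lemma tendsto_expectation_abs:
  assumes \<nu>: "\<And>n. real_distribution (\<nu> n)"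
    and int: "\<And>n. integrable (\<nu> n) (\<lambda>x. x\<^sup>2)" and one: "\<And>n. (\<integral>x. x\<^sup>2 \<partial>\<nu> n) = 1"
    and weak: "weak_conv_m \<nu> std_normal_distribution"
  shows "(\<lambda>n. \<integral>x. \<bar>x\<bar> \<partial>\<nu> n) \<longlonglongrightarrow> sqrt (2 / pi)"
proof (rule LIMSEQ_I)
  fix e :: real assume e: "e > 0"
  define K where "K = 3 / e"
  have K: "K > 0" using e by (simp add: K_def)
  interpret N: real_distribution std_normal_distribution by (rule real_dist_normal_dist)
  have trunc: "\<bar>(\<integral>x. \<bar>x\<bar> \<partial>\<nu> n) - (\<integral>x. min \<bar>x\<bar> K \<partial>\<nu> n)\<bar> \<le> e / 3" for n
    using real_distribution.expectation_abs_truncate[OF \<nu> int K, of n] one by (simp add: K_def)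
  have "\<bar>(\<integral>x. \<bar>x\<bar> \<partial>std_normal_distribution) - (\<integral>x. min \<bar>x\<bar> K \<partial>std_normal_distribution)\<bar> \<le> e / 3"
    using N.expectation_abs_truncate[OF _ K] std_normal_distribution_even_moments[of 1]
    by (simp add: K_def)
  then have truncN: "\<bar>sqrt (2 / pi) - (\<integral>x. min \<bar>x\<bar> K \<partial>std_normal_distribution)\<bar> \<le> e / 3"
    using std_normal_distribution_odd_moments_abs[of 0] by simp
  have "(\<lambda>n. \<integral>x. min \<bar>x\<bar> K \<partial>\<nu> n) \<longlonglongrightarrow> (\<integral>x. min \<bar>x\<bar> K \<partial>std_normal_distribution)"
    using \<nu> real_dist_normal_dist weak
    by (rule weak_conv_imp_integral_bdd_continuous_conv[where B = K])
       (use K in \<open>auto intro!: continuous_intros\<close>)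
  then obtain n0 where n0: "\<And>n. n \<ge> n0 \<Longrightarrow>
      norm ((\<integral>x. min \<bar>x\<bar> K \<partial>\<nu> n) - (\<integral>x. min \<bar>x\<bar> K \<partial>std_normal_distribution)) < e / 3"
    using LIMSEQ_D[of _ _ "e / 3"] e by (metis zero_less_divide_iff zero_less_numeral)
  have "norm ((\<integral>x. \<bar>x\<bar> \<partial>\<nu> n) - sqrt (2 / pi)) < e" if "n \<ge> n0" for n
    using n0[OF that] trunc[of n] truncN unfolding real_norm_def abs_le_iff abs_less_iff by linarith
  then show "\<exists>no. \<forall>n\<ge>no. norm ((\<integral>x. \<bar>x\<bar> \<partial>\<nu> n) - sqrt (2 / pi)) < e" by blast
qed

text \<open>The characteristic function is compared factor by factor with exp (- (x k * t)^2 / 2),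
  and these Gaussian factors multiply to exp (- t^2 / 2) because the squared weights sum to 1. Each
  error carries a factor (x k)^2, so the errors add up to a single quantity that vanishes with the
  largest weight. Index sets, variables and weights all vary with n, as the contradiction argument
  below requires.\<close>

lemma (in prob_space) expectation_abs_linear_form_tendsto:
  fixes X :: "nat \<Rightarrow> 'i \<Rightarrow> 'a \<Rightarrow> real" and x :: "nat \<Rightarrow> 'i \<Rightarrow> real"
  assumes \<mu>: "centered_unit_variance_law \<mu>"
    and fin: "\<And>n. finite (I n)" and ind: "\<And>n. indep_vars (\<lambda>_. borel) (X n) (I n)"
    and d: "\<And>n k. k \<in> I n \<Longrightarrow> distr M borel (X n k) = \<mu>"
    and norm1: "\<And>n. (\<Sum>k\<in>I n. (x n k)\<^sup>2) = 1"
    and small: "\<And>n k. k \<in> I n \<Longrightarrow> \<bar>x n k\<bar> \<le> h n" and h: "h \<longlonglongrightarrow> 0"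
  shows "(\<lambda>n. expectation (\<lambda>\<omega>. \<bar>\<Sum>k\<in>I n. x n k * X n k \<omega>\<bar>)) \<longlonglongrightarrow> sqrt (2 / pi)"
proof -
  interpret \<mu>: real_distribution \<mu> by (rule centered_unit_variance_lawD(1)[OF \<mu>])
  have \<mu>': "integrable \<mu> (\<lambda>x. x)" "integrable \<mu> (\<lambda>x. x\<^sup>2)" "\<mu>.expectation (\<lambda>x. x) = 0"
    "\<mu>.variance (\<lambda>x. x) = 1"
    using centered_unit_variance_lawD[OF \<mu>] by blast+
  define S where "S n \<omega> = (\<Sum>k\<in>I n. x n k * X n k \<omega>)" for n \<omega>
  have rv[measurable]: "X n k \<in> borel_measurable M" if "k \<in> I n" for n k
    using ind that by (auto simp: indep_vars_def2)
  have S[measurable]: "S n \<in> borel_measurable M" for n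
    unfolding S_def[abs_def] using rv by (intro borel_measurable_sum borel_measurable_times) auto
  have S2: "integrable M (\<lambda>\<omega>. (S n \<omega>)\<^sup>2)" "expectation (\<lambda>\<omega>. (S n \<omega>)\<^sup>2) = 1" for n
    using linear_form_second_moment[OF \<mu> fin ind d, of n "x n"] norm1[of n] by (simp_all add: S_def[abs_def])
  define \<nu> where "\<nu> n = distr M borel (S n)" for n
  have \<nu>: "real_distribution (\<nu> n)" for n unfolding \<nu>_def by (rule real_distribution_distr[OF S])
  \<comment> \<open>The error term of \<open>char_approx3\<close>. The minimum with 6 * y^2 keeps it
    finite under second moments alone, and supplies the dominating function for its limit 0 as u
    tends to 0.\<close>
  define \<delta> where "\<delta> u = \<mu>.expectation (\<lambda>y. min (6 * y\<^sup>2) (\<bar>u\<bar> * \<bar>y\<bar> ^ 3))" for u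
  have int_min: "integrable \<mu> (\<lambda>y. min (6 * y\<^sup>2) (\<bar>u\<bar> * \<bar>y\<bar> ^ 3))" for u
    by (rule Bochner_Integration.integrable_bound[OF integrable_mult_right[OF \<mu>'(2), of 6]]) auto
  have \<delta>_mono: "\<delta> u \<le> \<delta> w" if "\<bar>u\<bar> \<le> \<bar>w\<bar>" for u w
    unfolding \<delta>_def using that
    by (intro integral_mono int_min min.mono mult_right_mono) auto
  have char_S: "char (\<nu> n) t = (\<Prod>k\<in>I n. char \<mu> (x n k * t))" for n t
  proof -
    have "char (\<nu> n) t = (\<Prod>k\<in>I n. char (distr M borel (\<lambda>\<omega>. x n k * X n k \<omega>)) t)"
      unfolding \<nu>_def S_def[abs_def]
      by (rule char_distr_sum) (rule indep_vars_compose2[OF ind], simp)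
    also have "\<dots> = (\<Prod>k\<in>I n. char \<mu> (x n k * t))"
    proof (rule prod.cong[OF refl])
      fix k assume k: "k \<in> I n"
      show "char (distr M borel (\<lambda>\<omega>. x n k * X n k \<omega>)) t = char \<mu> (x n k * t)"
        unfolding char_def d[OF k, symmetric] using rv[OF k]
        by (simp add: integral_distr ac_simps)
    qed
    finally show ?thesis .
  qed
  have approx: "cmod (char \<mu> u - exp (- u\<^sup>2 / 2)) \<le> u\<^sup>2 * (\<delta> u / 6 + u\<^sup>2 / 8)" for u
  proof -
    have "cmod (char \<mu> u - (1 - u\<^sup>2 / 2)) \<le> u\<^sup>2 / 6 * \<delta> u"
      using \<mu>.char_approx3[OF \<mu>'(1,3,2,4), of u] by (simp add: \<delta>_def)
    moreover have "cmod (complex_of_real (1 - u\<^sup>2 / 2) - complex_of_real (exp (- u\<^sup>2 / 2)))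
        \<le> (u\<^sup>2 / 2)\<^sup>2 / 2"
    proof -
      have "cmod (complex_of_real (1 - u\<^sup>2 / 2) - complex_of_real (exp (- u\<^sup>2 / 2))) = cmod (of_real (1 - u\<^sup>2 / 2 - exp (- (u\<^sup>2 / 2))))"
        by simp
      also have "\<dots> = \<bar>1 - u\<^sup>2 / 2 - exp (- (u\<^sup>2 / 2))\<bar>" by (rule norm_of_real)
      also have "\<dots> \<le> (u\<^sup>2 / 2)\<^sup>2 / 2" by (rule exp_minus_diff_le) simp
      finally show ?thesis .
    qed
    ultimately have "cmod (char \<mu> u - exp (- u\<^sup>2 / 2)) \<le> u\<^sup>2 / 6 * \<delta> u + (u\<^sup>2 / 2)\<^sup>2 / 2"
      by (rule norm_diff_triangle_le)
    also have "\<dots> = u\<^sup>2 * (\<delta> u / 6 + u\<^sup>2 / 8)" by (simp add: power2_eq_square algebra_simps)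
    finally show ?thesis .
  qed
  have bound: "cmod (char (\<nu> n) t - exp (- t\<^sup>2 / 2)) \<le> t\<^sup>2 * (\<delta> (h n * t) / 6 + (h n * t)\<^sup>2 / 8)" for n t
  proof -
    have "(\<Sum>k\<in>I n. - (x n k * t)\<^sup>2 / 2) = (\<Sum>k\<in>I n. (x n k)\<^sup>2) * (- t\<^sup>2 / 2)"
      unfolding sum_distrib_right by (intro sum.cong) (simp_all add: power_mult_distrib)
    then have "exp (- t\<^sup>2 / 2) = (\<Prod>k\<in>I n. exp (- (x n k * t)\<^sup>2 / 2))"
      by (subst exp_sum[OF fin, symmetric]) (simp add: norm1)
    then have "cmod (char (\<nu> n) t - exp (- t\<^sup>2 / 2)) =
        cmod ((\<Prod>k\<in>I n. char \<mu> (x n k * t)) - (\<Prod>k\<in>I n. complex_of_real (exp (- (x n k * t)\<^sup>2 / 2))))"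
      by (simp only: char_S of_real_prod)
    also have "\<dots> \<le> (\<Sum>k\<in>I n. cmod (char \<mu> (x n k * t) - complex_of_real (exp (- (x n k * t)\<^sup>2 / 2))))"
      by (rule norm_prod_diff) (auto simp only: norm_of_real intro!: \<mu>.cmod_char_le_1, auto)
    also have "\<dots> \<le> (\<Sum>k\<in>I n. (x n k)\<^sup>2 * (t\<^sup>2 * (\<delta> (h n * t) / 6 + (h n * t)\<^sup>2 / 8)))"
    proof (rule sum_mono)
      fix k assume k: "k \<in> I n"
      have le: "\<bar>x n k * t\<bar> \<le> \<bar>h n * t\<bar>"
        using small[OF k] by (simp add: abs_mult mult_right_mono)
      have "cmod (char \<mu> (x n k * t) - complex_of_real (exp (- (x n k * t)\<^sup>2 / 2))) \<le>
          (x n k * t)\<^sup>2 * (\<delta> (x n k * t) / 6 + (x n k * t)\<^sup>2 / 8)"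
        by (rule approx)
      also have "\<dots> \<le> (x n k * t)\<^sup>2 * (\<delta> (h n * t) / 6 + (h n * t)\<^sup>2 / 8)"
        using \<delta>_mono[OF le] le by (intro mult_left_mono add_mono divide_right_mono) (auto simp: abs_le_square_iff)
      finally show "cmod (char \<mu> (x n k * t) - complex_of_real (exp (- (x n k * t)\<^sup>2 / 2))) \<le>
          (x n k)\<^sup>2 * (t\<^sup>2 * (\<delta> (h n * t) / 6 + (h n * t)\<^sup>2 / 8))"
        by (simp add: power_mult_distrib mult.assoc)
    qed
    also have "\<dots> = t\<^sup>2 * (\<delta> (h n * t) / 6 + (h n * t)\<^sup>2 / 8)"
      by (simp add: sum_distrib_right[symmetric] norm1)
    finally show ?thesis .
  qed
  have weak: "weak_conv_m \<nu> std_normal_distribution"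
  proof (rule levy_continuity[OF \<nu> real_dist_normal_dist])
    fix t :: real
    have ht: "(\<lambda>n. h n * t) \<longlonglongrightarrow> 0" using tendsto_mult_left_zero[OF h] .
    have "(\<lambda>n. min (6 * y\<^sup>2) (\<bar>h n * t\<bar> * \<bar>y\<bar> ^ 3)) \<longlonglongrightarrow> 0" for y :: real
    proof -
      have "(\<lambda>n. \<bar>h n * t\<bar> * \<bar>y\<bar> ^ 3) \<longlonglongrightarrow> 0"
        using tendsto_mult_left_zero[OF tendsto_rabs_zero[OF ht]] .
      from tendsto_min[OF tendsto_const this, of "6 * y\<^sup>2"] show ?thesis by (simp add: min_absorb2)
    qed
    then have "(\<lambda>n. \<delta> (h n * t)) \<longlonglongrightarrow> \<mu>.expectation (\<lambda>_. 0)"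
      unfolding \<delta>_def using \<mu>'(2)
      by (intro integral_dominated_convergence[where w = "\<lambda>y. 6 * y\<^sup>2"]) auto
    then have "(\<lambda>n. t\<^sup>2 * (\<delta> (h n * t) / 6 + (h n * t)\<^sup>2 / 8)) \<longlonglongrightarrow> t\<^sup>2 * (0 / 6 + 0\<^sup>2 / 8)"
      using ht by (intro tendsto_intros) auto
    then have "(\<lambda>n. t\<^sup>2 * (\<delta> (h n * t) / 6 + (h n * t)\<^sup>2 / 8)) \<longlonglongrightarrow> 0" by simp
    then have "(\<lambda>n. char (\<nu> n) t - exp (- t\<^sup>2 / 2)) \<longlonglongrightarrow> 0"
      by (rule Lim_null_comparison[OF always_eventually, rotated]) (use bound in blast)
    then show "(\<lambda>n. char (\<nu> n) t) \<longlonglongrightarrow> char std_normal_distribution t"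
      by (simp add: char_std_normal_distribution LIM_zero_cancel)
  qed
  have "(\<lambda>n. \<integral>y. \<bar>y\<bar> \<partial>\<nu> n) \<longlonglongrightarrow> sqrt (2 / pi)"
    using \<nu> _ _ weak by (rule tendsto_expectation_abs) (simp_all add: \<nu>_def integrable_distr_eq integral_distr S2)
  then show ?thesis by (simp add: \<nu>_def integral_distr S_def)
qed

text \<open>Uniformity by contradiction: were there no threshold \<eta>, counterexamples with the
  largest weight at most 1 / (n + 1) would form a sequence that violates the limit theorem.\<close>

lemma (in prob_space) expectation_abs_linear_form_approx:
  fixes \<epsilon> :: real
  assumes \<mu>: "centered_unit_variance_law \<mu>" and "\<epsilon> > 0"
  obtains \<eta> :: real where "\<eta> > 0"
    "\<And>(I :: 'i set) X x s. finite I \<Longrightarrow> indep_vars (\<lambda>_. borel) X I \<Longrightarrow>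
       (\<And>k. k \<in> I \<Longrightarrow> distr M borel (X k) = \<mu>) \<Longrightarrow> s > 0 \<Longrightarrow> (\<Sum>k\<in>I. (x k)\<^sup>2) = s\<^sup>2 \<Longrightarrow>
       (\<And>k. k \<in> I \<Longrightarrow> \<bar>x k\<bar> \<le> \<eta> * s) \<Longrightarrow>
       \<bar>expectation (\<lambda>\<omega>. \<bar>\<Sum>k\<in>I. x k * X k \<omega>\<bar>) - sqrt (2 / pi) * s\<bar> \<le> \<epsilon> * s"
proof -
  \<comment> \<open>The negated claim for unit vectors as a single predicate, so that one choice
    yields index set, variables and weights together. General x are reduced to it by dividing by
    s.\<close>
  define far where "far \<eta> I X x \<longleftrightarrow> finite I \<and> indep_vars (\<lambda>_. borel) X I \<and>
      (\<forall>k\<in>I. distr M borel (X k) = \<mu>) \<and> (\<Sum>k\<in>I. (x k)\<^sup>2) = 1 \<and> (\<forall>k\<in>I. \<bar>x k\<bar> \<le> \<eta>) \<and>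
      \<epsilon> < \<bar>expectation (\<lambda>\<omega>. \<bar>\<Sum>k\<in>I. x k * X k \<omega>\<bar>) - sqrt (2 / pi)\<bar>"
    for \<eta> :: real and I :: "'i set" and X :: "'i \<Rightarrow> 'a \<Rightarrow> real" and x :: "'i \<Rightarrow> real"
  have "\<exists>\<eta>>0. \<forall>I X x. \<not> far \<eta> I X x"
  proof (rule ccontr)
    assume "\<not> ?thesis"
    then have "\<And>\<eta>. \<eta> > 0 \<Longrightarrow> \<exists>I X x. far \<eta> I X x" by blast
    then have "\<exists>I X x. far (inverse (real (Suc n))) I X x" for n by simp
    then obtain I X x where *: "\<And>n. far (inverse (real (Suc n))) (I n) (X n) (x n)" by metis
    have c: "finite (I n)" "indep_vars (\<lambda>_. borel) (X n) (I n)"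
        "\<forall>k\<in>I n. distr M borel (X n k) = \<mu>" "(\<Sum>k\<in>I n. (x n k)\<^sup>2) = 1"
        "\<forall>k\<in>I n. \<bar>x n k\<bar> \<le> inverse (real (Suc n))"
        "\<epsilon> < \<bar>expectation (\<lambda>\<omega>. \<bar>\<Sum>k\<in>I n. x n k * X n k \<omega>\<bar>) - sqrt (2 / pi)\<bar>" for n
      using *[of n] unfolding far_def by - (elim conjE, assumption)+
    have "(\<lambda>n. expectation (\<lambda>\<omega>. \<bar>\<Sum>k\<in>I n. x n k * X n k \<omega>\<bar>)) \<longlonglongrightarrow> sqrt (2 / pi)"
      by (rule expectation_abs_linear_form_tendsto[OF \<mu> c(1,2) c(3)[rule_format] c(4) c(5)[rule_format]
            LIMSEQ_inverse_real_of_nat])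
    from LIMSEQ_D[OF this \<open>\<epsilon> > 0\<close>] obtain n where
      "norm (expectation (\<lambda>\<omega>. \<bar>\<Sum>k\<in>I n. x n k * X n k \<omega>\<bar>) - sqrt (2 / pi)) < \<epsilon>"
      by blast
    then show False using c(6)[of n] by simp
  qed
  then obtain \<eta> where \<eta>: "\<eta> > 0" and close: "\<And>I X x. \<not> far \<eta> I X x" by blast
  show thesis
  proof (rule that[OF \<eta>])
    fix I :: "'i set" and X x and s :: real
    assume A: "finite I" "indep_vars (\<lambda>_. borel) X I" "\<And>k. k \<in> I \<Longrightarrow> distr M borel (X k) = \<mu>"
      and s: "s > 0" and x: "(\<Sum>k\<in>I. (x k)\<^sup>2) = s\<^sup>2" "\<And>k. k \<in> I \<Longrightarrow> \<bar>x k\<bar> \<le> \<eta> * s"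
    have "\<bar>expectation (\<lambda>\<omega>. \<bar>\<Sum>k\<in>I. x k / s * X k \<omega>\<bar>) - sqrt (2 / pi)\<bar> \<le> \<epsilon>"
      using A s x close[of I X "\<lambda>k. x k / s"]
      by (auto simp: far_def power_divide sum_divide_distrib[symmetric] divide_le_eq)
    moreover have "(\<Sum>k\<in>I. x k / s * X k \<omega>) = (\<Sum>k\<in>I. x k * X k \<omega>) / s" for \<omega>
      by (simp add: sum_divide_distrib)
    ultimately have "\<bar>expectation (\<lambda>\<omega>. \<bar>\<Sum>k\<in>I. x k * X k \<omega>\<bar>) / s - sqrt (2 / pi)\<bar> \<le> \<epsilon>"
      using s by simp
    also have "expectation (\<lambda>\<omega>. \<bar>\<Sum>k\<in>I. x k * X k \<omega>\<bar>) / s - sqrt (2 / pi) =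
       (expectation (\<lambda>\<omega>. \<bar>\<Sum>k\<in>I. x k * X k \<omega>\<bar>) - sqrt (2 / pi) * s) / s"
      using s by (simp add: field_simps)
    finally show "\<bar>expectation (\<lambda>\<omega>. \<bar>\<Sum>k\<in>I. x k * X k \<omega>\<bar>) - sqrt (2 / pi) * s\<bar> \<le> \<epsilon> * s"
      using s by (simp add: divide_le_eq)
  qed
qed

section \<open>Multiplication by one random matrix\<close>

text \<open>Vectors and matrices are treated as functions of their indices, as these carry product
  sigma-algebras; values at indices out of range do not matter.\<close>

definition sq_norm :: "nat \<Rightarrow> (nat \<Rightarrow> real) \<Rightarrow> real" where
  "sq_norm m x = (\<Sum>k<m. (x k)\<^sup>2)"

definition row_times :: "nat \<Rightarrow> (nat \<Rightarrow> real) \<Rightarrow> (nat \<times> nat \<Rightarrow> real) \<Rightarrow> nat \<Rightarrow> real" where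
  "row_times m x f j = (\<Sum>k<m. x k * f (k, j))"

text \<open>The failure events of the multiplication of a row vector \<open>x\<close> by an \<open>m \<times> n\<close> matrix \<open>f\<close>. The first
  conjunct of \<open>bad_sum\<close> says that \<open>x\<close> has no dominating entry: the central limit theorem does not
  apply to other \<open>x\<close>, and those are excluded by \<open>bad_entry\<close> in the preceding step. All inequalities are
  strict, so that \<open>x = 0\<close> never fails.\<close>

definition bad_norm :: "real \<Rightarrow> nat \<Rightarrow> nat \<Rightarrow> (nat \<Rightarrow> real) \<Rightarrow> (nat \<times> nat \<Rightarrow> real) \<Rightarrow> bool" where
  "bad_norm \<epsilon> m n x f \<longleftrightarrow> \<epsilon> * (real n * sq_norm m x) < \<bar>(\<Sum>j<n. (row_times m x f j)\<^sup>2) - real n * sq_norm m x\<bar>"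

definition bad_entry :: "real \<Rightarrow> nat \<Rightarrow> nat \<Rightarrow> (nat \<Rightarrow> real) \<Rightarrow> (nat \<times> nat \<Rightarrow> real) \<Rightarrow> bool" where
  "bad_entry \<eta> m n x f \<longleftrightarrow> (\<exists>j<n. \<eta> * (sqrt (real n) * sqrt (sq_norm m x)) < \<bar>row_times m x f j\<bar>)"

definition bad_sum :: "real \<Rightarrow> real \<Rightarrow> nat \<Rightarrow> nat \<Rightarrow> (nat \<Rightarrow> real) \<Rightarrow> (nat \<times> nat \<Rightarrow> real) \<Rightarrow> bool" where
  "bad_sum \<epsilon> \<eta> m n x f \<longleftrightarrow> (\<forall>k<m. \<bar>x k\<bar> \<le> \<eta> * sqrt (sq_norm m x)) \<and>
     \<epsilon> * (real n * sqrt (sq_norm m x)) <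
       \<bar>(\<Sum>j<n. \<bar>row_times m x f j\<bar>) - real n * (sqrt (2 / pi) * sqrt (sq_norm m x))\<bar>"

lemma power2_powr_eq: "(x\<^sup>2) powr a = \<bar>x\<bar> powr (2 * a)" for x a :: real
proof (cases "x = 0")
  case False
  then have "x\<^sup>2 = \<bar>x\<bar> powr 2" by simp
  then show ?thesis by (simp only: powr_powr)
qed simp

section \<open>Failure probabilities of one multiplication\<close>

context prob_space begin

text \<open>Conditioning on X by way of Fubini: the joint law is a product, so a bound valid for
  every frozen value x survives integration over the law of X.\<close>

lemma prob_indep_var_le:
  assumes ind: "indep_var S X T Y"
    and Q[measurable]: "Measurable.pred (S \<Otimes>\<^sub>M T) (\<lambda>z. Q (fst z) (snd z))"
    and le: "\<And>x. x \<in> space S \<Longrightarrow> prob {\<omega> \<in> space M. Q x (Y \<omega>)} \<le> b"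
  shows "prob {\<omega> \<in> space M. Q (X \<omega>) (Y \<omega>)} \<le> b"
proof -
  have X[measurable]: "X \<in> measurable M S" and Y[measurable]: "Y \<in> measurable M T"
    and joint: "distr M S X \<Otimes>\<^sub>M distr M T Y = distr M (S \<Otimes>\<^sub>M T) (\<lambda>\<omega>. (X \<omega>, Y \<omega>))"
    using ind by (auto simp: indep_var_distribution_eq)
  interpret X: prob_space "distr M S X" by (rule prob_space_distr) simp
  interpret Y: prob_space "distr M T Y" by (rule prob_space_distr) simp
  define B where "B = {z \<in> space (S \<Otimes>\<^sub>M T). Q (fst z) (snd z)}"
  have B[measurable]: "B \<in> sets (S \<Otimes>\<^sub>M T)" unfolding B_def by measurable
  \<comment> \<open>That b is nonnegative follows from its being a bound for some x, so a point of
    \<open>space S\<close> has to be exhibited.\<close>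
  obtain \<omega>0 where "\<omega>0 \<in> space M" using not_empty by blast
  then have "X \<omega>0 \<in> space S" using measurable_space[OF X] by blast
  then have b: "b \<ge> 0" using le measure_nonneg order_trans by blast
  have "emeasure M {\<omega> \<in> space M. Q (X \<omega>) (Y \<omega>)} = emeasure (distr M (S \<Otimes>\<^sub>M T) (\<lambda>\<omega>. (X \<omega>, Y \<omega>))) B"
    by (subst emeasure_distr)
       (auto simp: B_def space_pair_measure intro!: arg_cong[where f = "emeasure M"]
         dest: measurable_space[OF X] measurable_space[OF Y])
  also have "\<dots> = emeasure (distr M S X \<Otimes>\<^sub>M distr M T Y) B" by (simp add: joint)
  also have "\<dots> = (\<integral>\<^sup>+x. emeasure (distr M T Y) (Pair x -` B) \<partial>distr M S X)"
    by (rule Y.emeasure_pair_measure_alt) simp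
  also have "\<dots> \<le> (\<integral>\<^sup>+x. ennreal b \<partial>distr M S X)"
  proof (rule nn_integral_mono)
    fix x assume "x \<in> space (distr M S X)"
    then have x: "x \<in> space S" by simp
    have "emeasure (distr M T Y) (Pair x -` B) = emeasure M {\<omega> \<in> space M. Q x (Y \<omega>)}"
      unfolding emeasure_distr[OF Y sets_Pair1[OF B]] using x
      by (auto simp: B_def space_pair_measure intro!: arg_cong[where f = "emeasure M"]
         dest: measurable_space[OF Y])
    also have "\<dots> \<le> ennreal b" using le[OF x] by (simp add: emeasure_eq_measure ennreal_leI)
    finally show "emeasure (distr M T Y) (Pair x -` B) \<le> ennreal b" .
  qed
  also have "\<dots> = ennreal b" by (simp add: X.emeasure_space_1[simplified])
  finally show ?thesis using b by (simp add: emeasure_eq_measure)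
qed

text \<open>Different columns use disjoint blocks of entries.\<close>

lemma indep_vars_columns:
  fixes X :: "nat \<times> nat \<Rightarrow> 'a \<Rightarrow> real"
  assumes "indep_vars (\<lambda>_. borel) X ({..<m} \<times> {..<n})"
  shows "indep_vars (\<lambda>_. borel) (\<lambda>j \<omega>. \<Sum>k<m. x k * X (k, j) \<omega>) {..<n}"
proof -
  have "indep_vars (\<lambda>j. PiM ({..<m} \<times> {j}) (\<lambda>_. borel))
      (\<lambda>j \<omega>. restrict (\<lambda>i. X i \<omega>) ({..<m} \<times> {j})) {..<n}"
    by (rule indep_vars_restrict[OF assms]) (auto simp: disjoint_family_on_def)
  then have "indep_vars (\<lambda>_. borel)
     (\<lambda>j \<omega>. (\<lambda>f. \<Sum>k<m. x k * f (k, j)) (restrict (\<lambda>i. X i \<omega>) ({..<m} \<times> {j}))) {..<n}"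
    by (rule indep_vars_compose2)
       (intro borel_measurable_sum borel_measurable_times borel_measurable_const
          measurable_component_singleton, auto)
  also have "(\<lambda>j \<omega>. \<Sum>k<m. x k * restrict (\<lambda>i. X i \<omega>) ({..<m} \<times> {j}) (k, j)) =
      (\<lambda>j \<omega>. \<Sum>k<m. x k * X (k, j) \<omega>)"
    by (intro ext sum.cong) auto
  finally show ?thesis .
qed

text \<open>The results on linear forms sum over the index set of the variables themselves, here
  pairs; \<open>fst\<close> recovers the index of the coefficient.\<close>

lemma sum_column_eq:
  fixes X :: "nat \<times> nat \<Rightarrow> 'a \<Rightarrow> real"
  shows "(\<Sum>k<m. f k * X (k, j) \<omega>) = (\<Sum>ij\<in>{..<m} \<times> {j}. f (fst ij) * X ij \<omega>)"
    "(\<Sum>k<m. (f k)\<^sup>2) = (\<Sum>ij\<in>{..<m} \<times> {j}. (f (fst ij))\<^sup>2)"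
  by (rule sum.reindex_bij_witness[of _ fst "\<lambda>k. (k, j)"]; auto)+

lemma column_moment_le:
  fixes \<mu> :: "real measure" and r :: real
  assumes \<mu>: "centered_unit_variance_law \<mu>" and fm: "finite_moment \<mu> r" and r: "r > 2"
  obtains D where "D > 0"
    "\<And>(X :: nat \<times> nat \<Rightarrow> 'a \<Rightarrow> real) m n (x :: nat \<Rightarrow> real) j. indep_vars (\<lambda>_. borel) X ({..<m} \<times> {..<n}) \<Longrightarrow>
       (\<And>ij. ij \<in> {..<m} \<times> {..<n} \<Longrightarrow> distr M borel (X ij) = \<mu>) \<Longrightarrow> j < n \<Longrightarrow>
       integrable M (\<lambda>\<omega>. \<bar>\<Sum>k<m. x k * X (k, j) \<omega>\<bar> powr r) \<and>
       expectation (\<lambda>\<omega>. \<bar>\<Sum>k<m. x k * X (k, j) \<omega>\<bar> powr r) \<le> (D * sqrt (\<Sum>k<m. (x k)\<^sup>2)) powr r"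
proof -
  obtain D where D: "D > 0"
    "\<And>(I :: (nat \<times> nat) set) X x. finite I \<Longrightarrow> indep_vars (\<lambda>_. borel) X I \<Longrightarrow>
       (\<And>k. k \<in> I \<Longrightarrow> distr M borel (X k) = \<mu>) \<Longrightarrow>
       integrable M (\<lambda>\<omega>. \<bar>\<Sum>k\<in>I. x k * X k \<omega>\<bar> powr r) \<and>
       expectation (\<lambda>\<omega>. \<bar>\<Sum>k\<in>I. x k * X k \<omega>\<bar> powr r) \<le> (D * sqrt (\<Sum>k\<in>I. (x k)\<^sup>2)) powr r"
    using linear_form_moment_le[OF r centered_unit_variance_lawD(1)[OF \<mu>]
        fm[unfolded finite_moment_def] centered_unit_variance_lawD(4)[OF \<mu>]] by blast
  show thesis
  proof (rule that[OF D(1)])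
    fix X :: "nat \<times> nat \<Rightarrow> 'a \<Rightarrow> real" and m n j :: nat and x :: "nat \<Rightarrow> real"
    assume ind: "indep_vars (\<lambda>_. borel) X ({..<m} \<times> {..<n})"
      and d: "\<And>ij. ij \<in> {..<m} \<times> {..<n} \<Longrightarrow> distr M borel (X ij) = \<mu>" and j: "j < n"
    show "integrable M (\<lambda>\<omega>. \<bar>\<Sum>k<m. x k * X (k, j) \<omega>\<bar> powr r) \<and>
       expectation (\<lambda>\<omega>. \<bar>\<Sum>k<m. x k * X (k, j) \<omega>\<bar> powr r) \<le> (D * sqrt (\<Sum>k<m. (x k)\<^sup>2)) powr r"
      unfolding sum_column_eq[where j = j]
      by (rule D(2)) (use d j in \<open>auto intro!: indep_vars_subset[OF ind]\<close>)
  qed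
qed

lemma column_second_moment:
  fixes X :: "nat \<times> nat \<Rightarrow> 'a \<Rightarrow> real"
  assumes \<mu>: "centered_unit_variance_law \<mu>"
    and ind: "indep_vars (\<lambda>_. borel) X ({..<m} \<times> {..<n})"
    and d: "\<And>ij. ij \<in> {..<m} \<times> {..<n} \<Longrightarrow> distr M borel (X ij) = \<mu>" and j: "j < n"
  shows "expectation (\<lambda>\<omega>. (\<Sum>k<m. x k * X (k, j) \<omega>)\<^sup>2) = (\<Sum>k<m. (x k)\<^sup>2)"
proof -
  have "indep_vars (\<lambda>_. borel) X ({..<m} \<times> {j})"
    using ind by (rule indep_vars_subset) (use j in auto)
  from linear_form_second_moment[OF \<mu> _ this, of "\<lambda>ij. x (fst ij)"] show ?thesis
    using d j unfolding sum_column_eq[where j = j] by auto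
qed

text \<open>The deviation bound of order 2 * \<alpha> is applied to the squares of the entries, with
  the squared norm of x as scale. A moment of order 2 * \<alpha> of a square is one of order 4 *
  \<alpha> of the entry, which is where D^2 comes from, and the mean of each square is exactly the
  squared norm of x.\<close>

lemma prob_norm_deviation_le:
  fixes \<mu> :: "real measure" and \<alpha> \<epsilon> :: real
  assumes \<mu>: "centered_unit_variance_law \<mu>" and fm: "finite_moment \<mu> (4 * \<alpha>)"
    and \<alpha>: "\<alpha> > 1" and \<epsilon>: "\<epsilon> > 0"
  obtains L where "L \<ge> 0"
    "\<And>(X :: nat \<times> nat \<Rightarrow> 'a \<Rightarrow> real) m n (x :: nat \<Rightarrow> real). n > 0 \<Longrightarrow> indep_vars (\<lambda>_. borel) X ({..<m} \<times> {..<n}) \<Longrightarrow>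
       (\<And>ij. ij \<in> {..<m} \<times> {..<n} \<Longrightarrow> distr M borel (X ij) = \<mu>) \<Longrightarrow>
       prob {\<omega> \<in> space M. bad_norm \<epsilon> m n x (\<lambda>ij. X ij \<omega>)} \<le> L * real n powr (- \<alpha>)"
proof -
  have r4: "4 * \<alpha> > 2" and r2: "2 * \<alpha> > 2" using \<alpha> by simp_all
  obtain D where D: "D > 0"
    "\<And>(X :: nat \<times> nat \<Rightarrow> 'a \<Rightarrow> real) m n (x :: nat \<Rightarrow> real) j. indep_vars (\<lambda>_. borel) X ({..<m} \<times> {..<n}) \<Longrightarrow>
       (\<And>ij. ij \<in> {..<m} \<times> {..<n} \<Longrightarrow> distr M borel (X ij) = \<mu>) \<Longrightarrow> j < n \<Longrightarrow>
       integrable M (\<lambda>\<omega>. \<bar>\<Sum>k<m. x k * X (k, j) \<omega>\<bar> powr (4 * \<alpha>)) \<and>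
       expectation (\<lambda>\<omega>. \<bar>\<Sum>k<m. x k * X (k, j) \<omega>\<bar> powr (4 * \<alpha>)) \<le> (D * sqrt (\<Sum>k<m. (x k)\<^sup>2)) powr (4 * \<alpha>)"
    using column_moment_le[OF \<mu> fm r4] by blast
  have D2: "D\<^sup>2 > 0" using D(1) by simp
  obtain L where L: "L \<ge> 0"
    "\<And>(J :: nat set) (Y :: nat \<Rightarrow> 'a \<Rightarrow> real) (s :: real). finite J \<Longrightarrow> J \<noteq> {} \<Longrightarrow> indep_vars (\<lambda>_. borel) Y J \<Longrightarrow> s > 0 \<Longrightarrow>
       (\<And>j. j \<in> J \<Longrightarrow> integrable M (\<lambda>\<omega>. \<bar>Y j \<omega>\<bar> powr (2 * \<alpha>))) \<Longrightarrow>
       (\<And>j. j \<in> J \<Longrightarrow> expectation (\<lambda>\<omega>. \<bar>Y j \<omega>\<bar> powr (2 * \<alpha>)) \<le> (D\<^sup>2 * s) powr (2 * \<alpha>)) \<Longrightarrow>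
       prob {\<omega> \<in> space M. \<epsilon> * (card J * s) < \<bar>(\<Sum>j\<in>J. Y j \<omega>) - (\<Sum>j\<in>J. expectation (Y j))\<bar>} \<le> L * card J powr (- (2 * \<alpha>) / 2)"
    using prob_sum_deviation_le[OF r2 D2 \<epsilon>] by blast
  show thesis
  proof (rule that[OF L(1)])
    fix X :: "nat \<times> nat \<Rightarrow> 'a \<Rightarrow> real" and m n :: nat and x :: "nat \<Rightarrow> real"
    assume n: "n > 0" and ind: "indep_vars (\<lambda>_. borel) X ({..<m} \<times> {..<n})"
      and d: "\<And>ij. ij \<in> {..<m} \<times> {..<n} \<Longrightarrow> distr M borel (X ij) = \<mu>"
    define T where "T j \<omega> = (\<Sum>k<m. x k * X (k, j) \<omega>)" for j \<omega>
    define s where "s = (\<Sum>k<m. (x k)\<^sup>2)"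
    have s0: "s \<ge> 0" by (simp add: s_def sum_nonneg)
    have "prob {\<omega> \<in> space M. \<epsilon> * (n * s) < \<bar>(\<Sum>j<n. (T j \<omega>)\<^sup>2) - n * s\<bar>} \<le> L * n powr (- \<alpha>)"
    proof (cases "s = 0")
      case True
      then have "\<forall>k\<in>{..<m}. (x k)\<^sup>2 = 0" unfolding s_def by (subst (asm) sum_nonneg_eq_0_iff) auto
      then have "T j \<omega> = 0" for j \<omega> by (simp add: T_def)
      then show ?thesis using True L(1) by simp
    next
      case False
      have indY: "indep_vars (\<lambda>_. borel) (\<lambda>j \<omega>. (T j \<omega>)\<^sup>2) {..<n}"
        unfolding T_def by (rule indep_vars_compose2[OF indep_vars_columns[OF ind]]) simp
      have pw: "\<bar>(t :: real)\<^sup>2\<bar> powr (2 * \<alpha>) = \<bar>t\<bar> powr (4 * \<alpha>)" for t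
        by (simp add: power2_powr_eq)
      have pw2: "(D\<^sup>2 * s) powr (2 * \<alpha>) = (D * sqrt s) powr (4 * \<alpha>)"
        using pw[of "D * sqrt s"] s0 D(1) by (simp add: power_mult_distrib)
      have mom: "integrable M (\<lambda>\<omega>. \<bar>T j \<omega>\<bar> powr (4 * \<alpha>)) \<and>
          expectation (\<lambda>\<omega>. \<bar>T j \<omega>\<bar> powr (4 * \<alpha>)) \<le> (D * sqrt s) powr (4 * \<alpha>)" if "j < n" for j
        unfolding T_def s_def by (rule D(2)[OF ind d that])
      have "prob {\<omega> \<in> space M. \<epsilon> * (card {..<n} * s) < \<bar>(\<Sum>j<n. (T j \<omega>)\<^sup>2) - (\<Sum>j<n. expectation (\<lambda>\<omega>. (T j \<omega>)\<^sup>2))\<bar>}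
          \<le> L * card {..<n} powr (- (2 * \<alpha>) / 2)"
      proof (rule L(2)[OF _ _ indY])
        fix j assume "j \<in> {..<n}"
        then have j: "j < n" by simp
        show "integrable M (\<lambda>\<omega>. \<bar>(T j \<omega>)\<^sup>2\<bar> powr (2 * \<alpha>))" unfolding pw using mom[OF j] by blast
        show "expectation (\<lambda>\<omega>. \<bar>(T j \<omega>)\<^sup>2\<bar> powr (2 * \<alpha>)) \<le> (D\<^sup>2 * s) powr (2 * \<alpha>)"
          unfolding pw pw2 using mom[OF j] by blast
      qed (use n s0 False in auto)
      moreover have "expectation (\<lambda>\<omega>. (T j \<omega>)\<^sup>2) = s" if "j < n" for j
        unfolding T_def s_def by (rule column_second_moment[OF \<mu> ind d that])
      ultimately show ?thesis by simp
    qed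
    then show "prob {\<omega> \<in> space M. bad_norm \<epsilon> m n x (\<lambda>ij. X ij \<omega>)} \<le> L * real n powr (- \<alpha>)"
      unfolding T_def s_def bad_norm_def bad_entry_def bad_sum_def sq_norm_def row_times_def .
  qed
qed

text \<open>Markov's inequality of order 4 * \<alpha> gives n powr (- 2 * \<alpha>) for one entry;
  the union over n columns costs a factor n, and 1 - 2 * \<alpha> \<le> - \<alpha>. An order of 2 *
  \<alpha> would leave n powr (1 - \<alpha>), a bound too weak for the later union over rows if
  \<alpha> \<le> 2.\<close>

lemma prob_large_entry_le:
  fixes \<mu> :: "real measure" and \<alpha> \<eta> :: real
  assumes \<mu>: "centered_unit_variance_law \<mu>" and fm: "finite_moment \<mu> (4 * \<alpha>)"
    and \<alpha>: "\<alpha> > 1" and \<eta>: "\<eta> > 0"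
  obtains L where "L \<ge> 0"
    "\<And>(X :: nat \<times> nat \<Rightarrow> 'a \<Rightarrow> real) m n (x :: nat \<Rightarrow> real). n > 0 \<Longrightarrow> indep_vars (\<lambda>_. borel) X ({..<m} \<times> {..<n}) \<Longrightarrow>
       (\<And>ij. ij \<in> {..<m} \<times> {..<n} \<Longrightarrow> distr M borel (X ij) = \<mu>) \<Longrightarrow>
       prob {\<omega> \<in> space M. bad_entry \<eta> m n x (\<lambda>ij. X ij \<omega>)}
         \<le> L * real n powr (- \<alpha>)"
proof -
  have r4: "4 * \<alpha> > 2" using \<alpha> by simp
  obtain D where D: "D > 0"
    "\<And>(X :: nat \<times> nat \<Rightarrow> 'a \<Rightarrow> real) m n (x :: nat \<Rightarrow> real) j. indep_vars (\<lambda>_. borel) X ({..<m} \<times> {..<n}) \<Longrightarrow>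
       (\<And>ij. ij \<in> {..<m} \<times> {..<n} \<Longrightarrow> distr M borel (X ij) = \<mu>) \<Longrightarrow> j < n \<Longrightarrow>
       integrable M (\<lambda>\<omega>. \<bar>\<Sum>k<m. x k * X (k, j) \<omega>\<bar> powr (4 * \<alpha>)) \<and>
       expectation (\<lambda>\<omega>. \<bar>\<Sum>k<m. x k * X (k, j) \<omega>\<bar> powr (4 * \<alpha>)) \<le> (D * sqrt (\<Sum>k<m. (x k)\<^sup>2)) powr (4 * \<alpha>)"
    using column_moment_le[OF \<mu> fm r4] by blast
  define L where "L = (D / \<eta>) powr (4 * \<alpha>)"
  show thesis
  proof (rule that[of L])
    fix X :: "nat \<times> nat \<Rightarrow> 'a \<Rightarrow> real" and m n :: nat and x :: "nat \<Rightarrow> real"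
    assume n: "n > 0" and ind: "indep_vars (\<lambda>_. borel) X ({..<m} \<times> {..<n})"
      and d: "\<And>ij. ij \<in> {..<m} \<times> {..<n} \<Longrightarrow> distr M borel (X ij) = \<mu>"
    define T where "T j \<omega> = (\<Sum>k<m. x k * X (k, j) \<omega>)" for j \<omega>
    define s where "s = sqrt (\<Sum>k<m. (x k)\<^sup>2)"
    have s0: "s \<ge> 0" by (simp add: s_def sum_nonneg)
    have T[measurable]: "T j \<in> borel_measurable M" if "j < n" for j
      using indep_vars_columns[OF ind, of x] that unfolding T_def[abs_def] by (auto simp: indep_vars_def2)
    have "prob {\<omega> \<in> space M. \<exists>j<n. \<eta> * (sqrt n * s) < \<bar>T j \<omega>\<bar>} \<le> L * n powr (- \<alpha>)"
    proof (cases "s = 0")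
      case True
      then have "\<forall>k\<in>{..<m}. (x k)\<^sup>2 = 0" unfolding s_def
        by (subst (asm) real_sqrt_eq_0_iff, subst (asm) sum_nonneg_eq_0_iff) auto
      then have "T j \<omega> = 0" for j \<omega> by (simp add: T_def)
      then show ?thesis using True by (simp add: L_def)
    next
      case False
      have single: "prob {\<omega> \<in> space M. \<eta> * (sqrt n * s) < \<bar>T j \<omega>\<bar>} \<le> L * n powr (- (2 * \<alpha>))"
        if j: "j < n" for j
      proof -
        have mom: "integrable M (\<lambda>\<omega>. \<bar>T j \<omega>\<bar> powr (4 * \<alpha>)) \<and>
          expectation (\<lambda>\<omega>. \<bar>T j \<omega>\<bar> powr (4 * \<alpha>)) \<le> (D * s) powr (4 * \<alpha>)"
          unfolding T_def s_def by (rule D(2)[OF ind d j])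
        have "prob {\<omega> \<in> space M. \<eta> * (sqrt n * s) < \<bar>T j \<omega>\<bar>} \<le> (D * s / (\<eta> * (sqrt n * s))) powr (4 * \<alpha>)"
          using mom T[OF j] \<eta> n s0 False \<alpha> by (intro prob_gt_le_moment) auto
        also have "D * s / (\<eta> * (sqrt n * s)) = D / \<eta> * n powr (- (1 / 2))"
          using False n by (simp add: powr_minus powr_half_sqrt field_simps)
        also have "\<dots> powr (4 * \<alpha>) = L * n powr (- (2 * \<alpha>))"
          unfolding powr_mult[of "D / \<eta>"] powr_powr L_def by simp
        finally show ?thesis .
      qed
      have "prob {\<omega> \<in> space M. \<exists>j<n. \<eta> * (sqrt n * s) < \<bar>T j \<omega>\<bar>} =
          prob (\<Union>j\<in>{..<n}. {\<omega> \<in> space M. \<eta> * (sqrt n * s) < \<bar>T j \<omega>\<bar>})"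
        by (rule arg_cong[where f = prob]) auto
      also have "\<dots> \<le> (\<Sum>j<n. prob {\<omega> \<in> space M. \<eta> * (sqrt n * s) < \<bar>T j \<omega>\<bar>})"
        by (rule finite_measure_subadditive_finite) (auto intro!: T)
      also have "\<dots> \<le> (\<Sum>j<n. L * n powr (- (2 * \<alpha>)))" by (intro sum_mono single) simp
      also have "\<dots> = L * (n powr 1 * n powr (- (2 * \<alpha>)))" using n by simp
      also have "\<dots> = L * n powr (1 - 2 * \<alpha>)" by (simp only: powr_add[symmetric]) simp
      also have "\<dots> \<le> L * n powr (- \<alpha>)"
        using n \<alpha> by (intro mult_left_mono powr_mono) (auto simp: L_def)
      finally show ?thesis .
    qed
    then show "prob {\<omega> \<in> space M. bad_entry \<eta> m n x (\<lambda>ij. X ij \<omega>)}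
         \<le> L * real n powr (- \<alpha>)"
      unfolding T_def s_def bad_norm_def bad_entry_def bad_sum_def sq_norm_def row_times_def .
  qed (simp add: L_def)
qed

text \<open>Half of \<epsilon> pays for the bias, the distance of the mean of each absolute value
  from its Gaussian value, and half for the fluctuation of the sum around its mean.\<close>

lemma prob_abs_sum_deviation_le:
  fixes \<mu> :: "real measure" and \<alpha> \<epsilon> :: real
  assumes \<mu>: "centered_unit_variance_law \<mu>" and fm: "finite_moment \<mu> (2 * \<alpha>)"
    and \<alpha>: "\<alpha> > 1" and \<epsilon>: "\<epsilon> > 0"
  obtains \<eta> L where "\<eta> > 0" "L \<ge> 0"
    "\<And>(X :: nat \<times> nat \<Rightarrow> 'a \<Rightarrow> real) m n (x :: nat \<Rightarrow> real). n > 0 \<Longrightarrow> indep_vars (\<lambda>_. borel) X ({..<m} \<times> {..<n}) \<Longrightarrow>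
       (\<And>ij. ij \<in> {..<m} \<times> {..<n} \<Longrightarrow> distr M borel (X ij) = \<mu>) \<Longrightarrow>
       prob {\<omega> \<in> space M. bad_sum \<epsilon> \<eta> m n x (\<lambda>ij. X ij \<omega>)}
         \<le> L * real n powr (- \<alpha>)"
proof -
  have r2: "2 * \<alpha> > 2" using \<alpha> by simp_all
  obtain D where D: "D > 0"
    "\<And>(X :: nat \<times> nat \<Rightarrow> 'a \<Rightarrow> real) m n (x :: nat \<Rightarrow> real) j. indep_vars (\<lambda>_. borel) X ({..<m} \<times> {..<n}) \<Longrightarrow>
       (\<And>ij. ij \<in> {..<m} \<times> {..<n} \<Longrightarrow> distr M borel (X ij) = \<mu>) \<Longrightarrow> j < n \<Longrightarrow>
       integrable M (\<lambda>\<omega>. \<bar>\<Sum>k<m. x k * X (k, j) \<omega>\<bar> powr (2 * \<alpha>)) \<and>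
       expectation (\<lambda>\<omega>. \<bar>\<Sum>k<m. x k * X (k, j) \<omega>\<bar> powr (2 * \<alpha>)) \<le> (D * sqrt (\<Sum>k<m. (x k)\<^sup>2)) powr (2 * \<alpha>)"
    using column_moment_le[OF \<mu> fm r2] by blast
  have e2: "\<epsilon> / 2 > 0" using \<epsilon> by simp
  obtain \<eta> where \<eta>: "\<eta> > 0"
    "\<And>(I :: (nat \<times> nat) set) X x s. finite I \<Longrightarrow> indep_vars (\<lambda>_. borel) X I \<Longrightarrow>
       (\<And>k. k \<in> I \<Longrightarrow> distr M borel (X k) = \<mu>) \<Longrightarrow> s > 0 \<Longrightarrow> (\<Sum>k\<in>I. (x k)\<^sup>2) = s\<^sup>2 \<Longrightarrow>
       (\<And>k. k \<in> I \<Longrightarrow> \<bar>x k\<bar> \<le> \<eta> * s) \<Longrightarrow>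
       \<bar>expectation (\<lambda>\<omega>. \<bar>\<Sum>k\<in>I. x k * X k \<omega>\<bar>) - sqrt (2 / pi) * s\<bar> \<le> \<epsilon> / 2 * s"
    using expectation_abs_linear_form_approx[OF \<mu> e2] by blast
  obtain L where L: "L \<ge> 0"
    "\<And>(J :: nat set) (Y :: nat \<Rightarrow> 'a \<Rightarrow> real) (s :: real). finite J \<Longrightarrow> J \<noteq> {} \<Longrightarrow> indep_vars (\<lambda>_. borel) Y J \<Longrightarrow> s > 0 \<Longrightarrow>
       (\<And>j. j \<in> J \<Longrightarrow> integrable M (\<lambda>\<omega>. \<bar>Y j \<omega>\<bar> powr (2 * \<alpha>))) \<Longrightarrow>
       (\<And>j. j \<in> J \<Longrightarrow> expectation (\<lambda>\<omega>. \<bar>Y j \<omega>\<bar> powr (2 * \<alpha>)) \<le> (D * s) powr (2 * \<alpha>)) \<Longrightarrow>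
       prob {\<omega> \<in> space M. \<epsilon> / 2 * (card J * s) < \<bar>(\<Sum>j\<in>J. Y j \<omega>) - (\<Sum>j\<in>J. expectation (Y j))\<bar>} \<le> L * card J powr (- (2 * \<alpha>) / 2)"
    using prob_sum_deviation_le[OF r2 D(1) e2] by blast
  show thesis
  proof (rule that[OF \<eta>(1) L(1)])
    fix X :: "nat \<times> nat \<Rightarrow> 'a \<Rightarrow> real" and m n :: nat and x :: "nat \<Rightarrow> real"
    assume n: "n > 0" and ind: "indep_vars (\<lambda>_. borel) X ({..<m} \<times> {..<n})"
      and d: "\<And>ij. ij \<in> {..<m} \<times> {..<n} \<Longrightarrow> distr M borel (X ij) = \<mu>"
    define T where "T j \<omega> = (\<Sum>k<m. x k * X (k, j) \<omega>)" for j \<omega>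
    define s where "s = sqrt (\<Sum>k<m. (x k)\<^sup>2)"
    have s0: "s \<ge> 0" by (simp add: s_def sum_nonneg)
    have s2: "(\<Sum>k<m. (x k)\<^sup>2) = s\<^sup>2" by (simp add: s_def sum_nonneg)
    have T[measurable]: "T j \<in> borel_measurable M" if "j < n" for j
      using indep_vars_columns[OF ind, of x] that unfolding T_def[abs_def] by (auto simp: indep_vars_def2)
    have "prob {\<omega> \<in> space M. (\<forall>k<m. \<bar>x k\<bar> \<le> \<eta> * s) \<and>
         \<epsilon> * (n * s) < \<bar>(\<Sum>j<n. \<bar>T j \<omega>\<bar>) - n * (sqrt (2 / pi) * s)\<bar>} \<le> L * n powr (- \<alpha>)"
    \<comment> \<open>The condition on the entries concerns x alone and not the outcome. Where it
      fails the event is empty, and otherwise the central limit estimate is available for every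
      column.\<close>
    proof (cases "s \<noteq> 0 \<and> (\<forall>k<m. \<bar>x k\<bar> \<le> \<eta> * s)")
      case False
      show ?thesis
      proof (cases "s = 0")
        case True
        then have "\<forall>k\<in>{..<m}. (x k)\<^sup>2 = 0" using s2 by (subst (asm) True, simp add: sum_nonneg_eq_0_iff)
        then have "T j \<omega> = 0" for j \<omega> by (simp add: T_def)
        then show ?thesis using True L(1) by simp
      next
        case s: False
        with False have "(\<forall>k<m. \<bar>x k\<bar> \<le> \<eta> * s) = False" by blast
        then show ?thesis unfolding \<open>(\<forall>k<m. \<bar>x k\<bar> \<le> \<eta> * s) = False\<close> using L(1) by simp
      qed
    next
      case True
      then have s: "s > 0" using s0 by simp
      have indT: "indep_vars (\<lambda>_. borel) T {..<n}" unfolding T_def by (rule indep_vars_columns[OF ind])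
      have indY: "indep_vars (\<lambda>_. borel) (\<lambda>j \<omega>. \<bar>T j \<omega>\<bar>) {..<n}"
        by (rule indep_vars_compose2[OF indT]) simp
      define c where "c j = expectation (\<lambda>\<omega>. \<bar>T j \<omega>\<bar>)" for j
      have c: "\<bar>c j - sqrt (2 / pi) * s\<bar> \<le> \<epsilon> / 2 * s" if "j < n" for j
        unfolding c_def T_def sum_column_eq[where j = j]
        by (rule \<eta>(2)) (use True that s d in \<open>auto intro!: indep_vars_subset[OF ind] simp: sum_column_eq(2)[symmetric] s2\<close>)
      have "prob {\<omega> \<in> space M. \<epsilon> / 2 * (card {..<n} * s) < \<bar>(\<Sum>j<n. \<bar>T j \<omega>\<bar>) - (\<Sum>j<n. expectation (\<lambda>\<omega>. \<bar>T j \<omega>\<bar>))\<bar>}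
          \<le> L * card {..<n} powr (- (2 * \<alpha>) / 2)"
      proof (rule L(2)[OF _ _ indY s])
        fix j assume "j \<in> {..<n}"
        then have j: "j < n" by simp
        have mom: "integrable M (\<lambda>\<omega>. \<bar>T j \<omega>\<bar> powr (2 * \<alpha>)) \<and>
            expectation (\<lambda>\<omega>. \<bar>T j \<omega>\<bar> powr (2 * \<alpha>)) \<le> (D * s) powr (2 * \<alpha>)"
          unfolding T_def s_def by (rule D(2)[OF ind d j])
        then show "integrable M (\<lambda>\<omega>. \<bar>\<bar>T j \<omega>\<bar>\<bar> powr (2 * \<alpha>))"
          "expectation (\<lambda>\<omega>. \<bar>\<bar>T j \<omega>\<bar>\<bar> powr (2 * \<alpha>)) \<le> (D * s) powr (2 * \<alpha>)" by simp_all
      qed (use n in auto)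
      then have *: "prob {\<omega> \<in> space M. \<epsilon> / 2 * (n * s) < \<bar>(\<Sum>j<n. \<bar>T j \<omega>\<bar>) - (\<Sum>j<n. c j)\<bar>} \<le> L * n powr (- \<alpha>)"
        by (simp add: c_def)
      have sub: "\<epsilon> / 2 * (n * s) < \<bar>y - (\<Sum>j<n. c j)\<bar>" if "\<epsilon> * (n * s) < \<bar>y - n * (sqrt (2 / pi) * s)\<bar>" for y
      proof -
        have "\<bar>(\<Sum>j<n. c j) - n * (sqrt (2 / pi) * s)\<bar> = \<bar>\<Sum>j<n. c j - sqrt (2 / pi) * s\<bar>"
          by (simp add: sum_subtractf)
        also have "\<dots> \<le> (\<Sum>j<n. \<epsilon> / 2 * s)"
          by (rule order_trans[OF sum_abs]) (intro sum_mono c, simp)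
        finally have "\<bar>(\<Sum>j<n. c j) - n * (sqrt (2 / pi) * s)\<bar> \<le> \<epsilon> / 2 * (n * s)"
          by (simp add: mult.left_commute)
        moreover have "\<epsilon> / 2 * (n * s) + \<epsilon> / 2 * (n * s) = \<epsilon> * (n * s)" by simp
        ultimately show ?thesis using that by linarith
      qed
      have "prob {\<omega> \<in> space M. (\<forall>k<m. \<bar>x k\<bar> \<le> \<eta> * s) \<and>
         \<epsilon> * (n * s) < \<bar>(\<Sum>j<n. \<bar>T j \<omega>\<bar>) - n * (sqrt (2 / pi) * s)\<bar>} \<le>
         prob {\<omega> \<in> space M. \<epsilon> / 2 * (n * s) < \<bar>(\<Sum>j<n. \<bar>T j \<omega>\<bar>) - (\<Sum>j<n. c j)\<bar>}"
      proof (rule finite_measure_mono)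
        have "(\<lambda>\<omega>. \<Sum>j<n. \<bar>T j \<omega>\<bar>) \<in> borel_measurable M" by (intro borel_measurable_sum borel_measurable_abs T) simp
        then show "{\<omega> \<in> space M. \<epsilon> / 2 * (n * s) < \<bar>(\<Sum>j<n. \<bar>T j \<omega>\<bar>) - (\<Sum>j<n. c j)\<bar>} \<in> events" by measurable
      qed (use sub in blast)
      then show ?thesis using * by linarith
    qed
    then show "prob {\<omega> \<in> space M. bad_sum \<epsilon> \<eta> m n x (\<lambda>ij. X ij \<omega>)}
         \<le> L * real n powr (- \<alpha>)"
      unfolding T_def s_def bad_norm_def bad_entry_def bad_sum_def sq_norm_def row_times_def .
  qed
qed

end

section \<open>Rows of the matrix product\<close>

lemma abs_diff_one_le_abs_power2_diff_one:
  fixes t :: real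
  assumes "t \<ge> 0"
  shows "\<bar>t - 1\<bar> \<le> \<bar>t\<^sup>2 - 1\<bar>"
proof -
  have "\<bar>t - 1\<bar> * 1 \<le> \<bar>t - 1\<bar> * \<bar>t + 1\<bar>" using assms by (intro mult_left_mono) auto
  also have "\<dots> = \<bar>t\<^sup>2 - 1\<bar>" by (simp add: abs_mult[symmetric] power2_eq_square algebra_simps)
  finally show ?thesis by simp
qed

text \<open>The bound (1 + \<epsilon>) ^ q - 1 reproduces itself: the ratio so far is at most (1 +
  \<epsilon>) ^ q, so one more step adds at most \<epsilon> * (1 + \<epsilon>) ^ q.\<close>

lemma ratio_prod_deviation_le:
  fixes s n :: "nat \<Rightarrow> real" and \<epsilon> :: real
  assumes "\<epsilon> > 0" and n: "\<And>q. q \<le> m \<Longrightarrow> n q > 0" and s0: "s 0 = 1"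
    and step: "\<And>q. q < m \<Longrightarrow> \<bar>s (Suc q) - n (Suc q) * s q\<bar> \<le> \<epsilon> * (n (Suc q) * s q)"
  shows "q \<le> m \<Longrightarrow> \<bar>s q / (\<Prod>l=1..q. n l) - 1\<bar> \<le> (1 + \<epsilon>) ^ q - 1"
proof (induction q)
  case (Suc q)
  define N where "N = (\<Prod>l=1..q. n l)"
  have N: "N > 0" unfolding N_def using n Suc.prems by (intro prod_pos) auto
  note n = n[OF Suc.prems]
  have IH: "\<bar>s q / N - 1\<bar> \<le> (1 + \<epsilon>) ^ q - 1" using Suc unfolding N_def by simp
  have "\<bar>s (Suc q) - n (Suc q) * s q\<bar> / (N * n (Suc q)) \<le> \<epsilon> * (n (Suc q) * s q) / (N * n (Suc q))"
    using step[of q] Suc.prems N n by (intro divide_right_mono) (auto simp: less_imp_le)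
  also have "\<dots> = \<epsilon> * (s q / N)" using n by simp
  also have "\<bar>s (Suc q) - n (Suc q) * s q\<bar> / (N * n (Suc q)) = \<bar>(s (Suc q) - n (Suc q) * s q) / (N * n (Suc q))\<bar>"
    using N n by simp
  also have "(s (Suc q) - n (Suc q) * s q) / (N * n (Suc q)) = s (Suc q) / (N * n (Suc q)) - s q / N"
    using N n by (simp add: field_simps)
  finally have "\<bar>s (Suc q) / (N * n (Suc q)) - s q / N\<bar> \<le> \<epsilon> * (s q / N)" .
  moreover have "\<epsilon> * (s q / N) \<le> \<epsilon> * (1 + \<epsilon>) ^ q" using IH \<open>\<epsilon> > 0\<close> by (intro mult_left_mono) auto
  ultimately have "\<bar>s (Suc q) / (N * n (Suc q)) - 1\<bar> \<le> \<epsilon> * (1 + \<epsilon>) ^ q + ((1 + \<epsilon>) ^ q - 1)" using IH by linarith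
  also have "\<dots> = (1 + \<epsilon>) ^ Suc q - 1" by (simp add: algebra_simps)
  finally show ?case by (simp add: N_def)
qed (simp add: s0)

lemma sq_norm_restrict: "sq_norm m (restrict x {..<m}) = sq_norm m x"
  unfolding sq_norm_def by (rule sum.cong) auto

lemma row_times_restrict:
  "j < n \<Longrightarrow> row_times m (restrict x {..<m}) (restrict f ({..<m} \<times> {..<n})) j = row_times m x f j"
  "j < n \<Longrightarrow> row_times m x (restrict f ({..<m} \<times> {..<n})) j = row_times m x f j"
  "row_times m (restrict x {..<m}) f j = row_times m x f j"
  unfolding row_times_def by (auto intro!: sum.cong)

text \<open>Elements of the product spaces are extensional functions, while the vectors and matrices
  in use are not; the failure events do not see the difference.\<close>

lemma bad_restrict:
  "bad_norm \<epsilon> m n (restrict x {..<m}) (restrict f ({..<m} \<times> {..<n})) = bad_norm \<epsilon> m n x f"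
  "bad_entry \<eta> m n (restrict x {..<m}) (restrict f ({..<m} \<times> {..<n})) = bad_entry \<eta> m n x f"
  "bad_sum \<epsilon> \<eta> m n (restrict x {..<m}) (restrict f ({..<m} \<times> {..<n})) = bad_sum \<epsilon> \<eta> m n x f"
  "bad_norm \<epsilon> m n x (restrict f ({..<m} \<times> {..<n})) = bad_norm \<epsilon> m n x f"
  "bad_entry \<eta> m n x (restrict f ({..<m} \<times> {..<n})) = bad_entry \<eta> m n x f"
  "bad_sum \<epsilon> \<eta> m n x (restrict f ({..<m} \<times> {..<n})) = bad_sum \<epsilon> \<eta> m n x f"
  unfolding bad_norm_def bad_entry_def bad_sum_def
  by (simp_all add: sq_norm_restrict row_times_restrict cong: conj_cong)

lemma measurable_bad:
  fixes m n
  defines "P \<equiv> PiM {..<m} (\<lambda>_. borel) \<Otimes>\<^sub>M PiM ({..<m} \<times> {..<n}) (\<lambda>_. borel)"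
  shows "Measurable.pred P (\<lambda>z. bad_norm \<epsilon> m n (fst z) (snd z))"
    "Measurable.pred P (\<lambda>z. bad_entry \<eta> m n (fst z) (snd z))"
    "Measurable.pred P (\<lambda>z. bad_sum \<epsilon> \<eta> m n (fst z) (snd z))"
proof -
  have x[measurable]: "(\<lambda>z. fst z k) \<in> borel_measurable P" if "k < m" for k
    unfolding P_def using that
    by (intro measurable_compose[OF measurable_fst measurable_component_singleton]) simp
  have f: "(\<lambda>z. snd z (k, j)) \<in> borel_measurable P" if "k < m" "j < n" for k j
    unfolding P_def using that
    by (intro measurable_compose[OF measurable_snd measurable_component_singleton]) simp
  have [measurable]: "(\<lambda>z. sq_norm m (fst z)) \<in> borel_measurable P"
    unfolding sq_norm_def by (intro borel_measurable_sum borel_measurable_power x) simp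
  have v[measurable]: "(\<lambda>z. row_times m (fst z) (snd z) j) \<in> borel_measurable P" if "j < n" for j
    unfolding row_times_def using that by (intro borel_measurable_sum borel_measurable_times x f) auto
  have [measurable]: "(\<lambda>z. \<Sum>j<n. (row_times m (fst z) (snd z) j)\<^sup>2) \<in> borel_measurable P"
    by (intro borel_measurable_sum borel_measurable_power v) simp
  have [measurable]: "(\<lambda>z. \<Sum>j<n. \<bar>row_times m (fst z) (snd z) j\<bar>) \<in> borel_measurable P"
    by (intro borel_measurable_sum borel_measurable_abs v) simp
  show "Measurable.pred P (\<lambda>z. bad_norm \<epsilon> m n (fst z) (snd z))"
    unfolding bad_norm_def by measurable
  have "Measurable.pred P (\<lambda>z. \<exists>j\<in>{..<n}. \<eta> * (sqrt (real n) * sqrt (sq_norm m (fst z))) < \<bar>row_times m (fst z) (snd z) j\<bar>)"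
    by (rule pred_intros_finite) (auto, measurable)
  then show "Measurable.pred P (\<lambda>z. bad_entry \<eta> m n (fst z) (snd z))"
    unfolding bad_entry_def by (simp add: Bex_def)
  have "Measurable.pred P (\<lambda>z. \<forall>k\<in>{..<m}. \<bar>fst z k\<bar> \<le> \<eta> * sqrt (sq_norm m (fst z)))"
    by (rule pred_intros_finite) (auto, measurable)
  then have [measurable]: "Measurable.pred P (\<lambda>z. \<forall>k<m. \<bar>fst z k\<bar> \<le> \<eta> * sqrt (sq_norm m (fst z)))"
    by (simp add: Ball_def)
  show "Measurable.pred P (\<lambda>z. bad_sum \<epsilon> \<eta> m n (fst z) (snd z))"
    unfolding bad_sum_def by measurable
qed

section \<open>The row of a product as an iterated multiplication\<close>

text \<open>Row i of the product of the first q matrices. Starting at a unit vector instead of row i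
  of the first matrix makes all p multiplications alike, and gives the initial squared norm
  1.\<close>

primrec rowvec :: "(nat \<Rightarrow> nat) \<Rightarrow> (nat \<Rightarrow> nat \<times> nat \<Rightarrow> real) \<Rightarrow> nat \<Rightarrow> nat \<Rightarrow> nat \<Rightarrow> real" where
  "rowvec n a i 0 = (\<lambda>j. of_bool (j = i))"
| "rowvec n a i (Suc q) = row_times (n q) (rowvec n a i q) (a (Suc q))"

lemma rowvec_cong:
  assumes "\<And>r ij. r \<in> {1..q} \<Longrightarrow> ij \<in> {..<n (r - 1)} \<times> {..<n r} \<Longrightarrow> a r ij = b r ij" and "j < n q"
  shows "rowvec n a i q j = rowvec n b i q j"
  using assms
proof (induction q arbitrary: j)
  case (Suc q)
  have "rowvec n a i q k = rowvec n b i q k" if "k < n q" for k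
    using Suc.prems(1) that by (intro Suc.IH) auto
  then show ?case using Suc.prems by (auto simp: row_times_def intro!: sum.cong)
qed simp

lemma measurable_rowvec:
  assumes "{1..q} \<subseteq> Q" and "j < n q"
  shows "(\<lambda>f. rowvec n f i q j) \<in>
    borel_measurable (PiM Q (\<lambda>r. PiM ({..<n (r - 1)} \<times> {..<n r}) (\<lambda>_. borel)))"
  using assms
proof (induction q arbitrary: j)
  case (Suc q)
  let ?N = "PiM Q (\<lambda>r. PiM ({..<n (r - 1)} \<times> {..<n r}) (\<lambda>_. borel :: real measure))"
  have a: "(\<lambda>f. f (Suc q)) \<in> measurable ?N (PiM ({..<n q} \<times> {..<n (Suc q)}) (\<lambda>_. borel))"
    using measurable_component_singleton[of "Suc q" Q "\<lambda>r. PiM ({..<n (r - 1)} \<times> {..<n r}) (\<lambda>_. borel :: real measure)"]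
      Suc.prems by (auto simp: subset_iff)
  have "(\<lambda>f. f (Suc q) (k, j)) \<in> borel_measurable ?N" if "k < n q" for k
    using Suc.prems that
    by (intro measurable_compose[OF a measurable_component_singleton]) auto
  moreover have "(\<lambda>f. rowvec n f i q k) \<in> borel_measurable ?N" if "k < n q" for k
    using Suc.prems that by (intro Suc.IH) auto
  ultimately show ?case
    by (auto simp: row_times_def intro!: borel_measurable_sum borel_measurable_times)
qed simp

lemma mat_product_Suc:
  "q \<ge> 1 \<Longrightarrow> mat_product (Suc q) A = mat_product q A * A (Suc q)"
  by (simp add: mat_product_def)

lemma mat_product_rowvec:
  assumes "\<And>r. r \<in> {1..q} \<Longrightarrow> A r \<in> carrier_mat (n (r - 1)) (n r)" and "q \<ge> 1"
  shows "mat_product q A \<in> carrier_mat (n 0) (n q) \<and>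
    (\<forall>i<n 0. \<forall>j<n q. mat_product q A $$ (i, j) = rowvec n (\<lambda>r ij. A r $$ ij) i q j)"
  using assms(2,1)
proof (induction q rule: dec_induct)
  case base
  have "mat_product 1 A = A 1" by (simp add: mat_product_def)
  moreover have "A 1 \<in> carrier_mat (n 0) (n 1)" using base.prems[of 1] by simp
  moreover have "rowvec n (\<lambda>r ij. A r $$ ij) i 1 j = A 1 $$ (i, j)" if "i < n 0" for i j
    using that by (simp add: row_times_def of_bool_def if_distrib[of "\<lambda>x. x * _"] cong: if_cong)
  ultimately show ?case by simp
next
  case (step q)
  have IH: "mat_product q A \<in> carrier_mat (n 0) (n q)"
    "\<And>i j. i < n 0 \<Longrightarrow> j < n q \<Longrightarrow> mat_product q A $$ (i, j) = rowvec n (\<lambda>r ij. A r $$ ij) i q j"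
    using step.IH step.prems by auto
  have A: "A (Suc q) \<in> carrier_mat (n q) (n (Suc q))" using step.prems[of "Suc q"] by simp
  have "(mat_product q A * A (Suc q)) $$ (i, j) = rowvec n (\<lambda>r ij. A r $$ ij) i (Suc q) j"
    if "i < n 0" "j < n (Suc q)" for i j
  proof -
    have "(mat_product q A * A (Suc q)) $$ (i, j) = (\<Sum>k<n q. mat_product q A $$ (i, k) * A (Suc q) $$ (k, j))"
      using IH(1) A that by (simp add: scalar_prod_def atLeast0LessThan)
    then show ?thesis using IH(2) that by (simp add: row_times_def)
  qed
  moreover have "mat_product q A * A (Suc q) \<in> carrier_mat (n 0) (n (Suc q))"
    using IH(1) A by (rule mult_carrier_mat)
  ultimately show ?case using step.hyps by (simp add: mat_product_Suc)
qed

text \<open>The deterministic part: one row outside its failure events. The entry condition has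
  \<eta> / 2 because it is relative to the expected norm, whereas the sum condition needs \<eta>
  relative to the norm attained; \<epsilon> \<le> 1/2 bounds the loss between the two by a factor
  2.\<close>

lemma row_sum_deviation_le:
  fixes n :: "nat \<Rightarrow> nat" and m :: nat
  assumes \<epsilon>: "0 < \<epsilon>" "\<epsilon> \<le> 1/2" and \<eta>: "\<eta> > 0" and n: "\<And>q. q \<le> Suc (Suc m) \<Longrightarrow> n q > 0" and i: "i < n 0"
    and norm: "\<And>q. q < Suc m \<Longrightarrow> \<not> bad_norm \<epsilon> (n q) (n (Suc q)) (rowvec n a i q) (a (Suc q))"
    and entry: "\<not> bad_entry (\<eta> / 2) (n m) (n (Suc m)) (rowvec n a i m) (a (Suc m))"
    and sum: "\<not> bad_sum \<epsilon> \<eta> (n (Suc m)) (n (Suc (Suc m))) (rowvec n a i (Suc m)) (a (Suc (Suc m)))"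
  shows "\<bar>inverse (real (n (Suc (Suc m)))) * (\<Prod>q=1..Suc m. real (n q)) powr (- (1/2)) *
      (\<Sum>j<n (Suc (Suc m)). \<bar>rowvec n a i (Suc (Suc m)) j\<bar>) - sqrt (2 / pi)\<bar> \<le> (1 + \<epsilon>) ^ Suc (Suc m) - 1"
proof -
  define x where "x = rowvec n a i"
  define s where "s q = sq_norm (n q) (x q)" for q
  define N where "N = (\<Prod>q=1..Suc m. real (n q))"
  define R where "R = (\<Sum>j<n (Suc (Suc m)). \<bar>x (Suc (Suc m)) j\<bar>)"
  define c where "c = sqrt (2 / pi)"
  have c: "0 \<le> c" "c \<le> 1" using pi_gt3 by (auto simp: c_def)
  have N: "N > 0" unfolding N_def using n by (intro prod_pos) auto
  have s_nonneg: "s q \<ge> 0" for q by (simp add: s_def sq_norm_def sum_nonneg)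
  have s0: "s 0 = 1" using i by (simp add: s_def sq_norm_def x_def of_bool_def if_distrib[of "\<lambda>x. x\<^sup>2"] cong: if_cong)
  have step: "\<bar>s (Suc q) - n (Suc q) * s q\<bar> \<le> \<epsilon> * (n (Suc q) * s q)" if "q < Suc m" for q
    using norm[OF that] by (simp add: bad_norm_def not_less s_def x_def sq_norm_def)
  have ratio: "\<bar>s (Suc m) / N - 1\<bar> \<le> (1 + \<epsilon>) ^ Suc m - 1"
    unfolding N_def using n by (intro ratio_prod_deviation_le[OF \<epsilon>(1) _ s0 step]) auto
  \<comment> \<open>The norm of the last vector before the final multiplication, relative to its
    expected size sqrt N.\<close>
  define t where "t = sqrt (s (Suc m) / N)"
  have t0: "t \<ge> 0" using s_nonneg N by (simp add: t_def)
  have "t\<^sup>2 = s (Suc m) / N" using s_nonneg N by (simp add: t_def)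
  then have t: "\<bar>t - 1\<bar> \<le> (1 + \<epsilon>) ^ Suc m - 1"
    using abs_diff_one_le_abs_power2_diff_one[OF t0] ratio by simp
  \<comment> \<open>The last vector is not much shorter than expected, so the bound on its entries is relative to
    its own norm.\<close>
  have "n (Suc m) * s m \<le> 2 * s (Suc m)"
  proof -
    have "\<epsilon> * (n (Suc m) * s m) \<le> 1/2 * (n (Suc m) * s m)"
      using \<epsilon> s_nonneg by (intro mult_right_mono) auto
    then show ?thesis using step[of m] by (simp add: abs_le_iff)
  qed
  \<comment> \<open>A generous step to a perfect square, whose root 2 cancels against \<eta> /
    2.\<close>
  also have "\<dots> \<le> 2\<^sup>2 * s (Suc m)" using s_nonneg[of "Suc m"] by simp
  finally have "sqrt (n (Suc m) * s m) \<le> sqrt (2\<^sup>2 * s (Suc m))" by (rule real_sqrt_le_mono)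
  then have "sqrt (n (Suc m)) * sqrt (s m) \<le> 2 * sqrt (s (Suc m))"
    by (simp only: real_sqrt_mult) simp
  then have "\<eta> / 2 * (sqrt (n (Suc m)) * sqrt (s m)) \<le> \<eta> * sqrt (s (Suc m))"
    using \<eta> by (simp add: mult_left_mono)
  moreover have "\<bar>x (Suc m) k\<bar> \<le> \<eta> / 2 * (sqrt (n (Suc m)) * sqrt (s m))" if "k < n (Suc m)" for k
  proof -
    have "\<not> \<eta> / 2 * (sqrt (n (Suc m)) * sqrt (s m)) < \<bar>x (Suc m) k\<bar>"
      using entry that unfolding bad_entry_def s_def x_def rowvec.simps(2) by blast
    then show ?thesis by simp
  qed
  ultimately have "\<forall>k<n (Suc m). \<bar>x (Suc m) k\<bar> \<le> \<eta> * sqrt (s (Suc m))" by (meson order_trans)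
  then have "\<bar>R - n (Suc (Suc m)) * (c * sqrt (s (Suc m)))\<bar> \<le> \<epsilon> * (n (Suc (Suc m)) * sqrt (s (Suc m)))"
    using sum by (simp add: bad_sum_def not_less R_def s_def x_def c_def)
  then have "\<bar>R - n (Suc (Suc m)) * (c * sqrt (s (Suc m)))\<bar> / (n (Suc (Suc m)) * sqrt N) \<le>
      \<epsilon> * (n (Suc (Suc m)) * sqrt (s (Suc m))) / (n (Suc (Suc m)) * sqrt N)"
    using N by (intro divide_right_mono) auto
  also have "\<dots> = \<epsilon> * t" using n[of "Suc (Suc m)"] by (simp add: t_def real_sqrt_divide)
  also have "\<bar>R - n (Suc (Suc m)) * (c * sqrt (s (Suc m)))\<bar> / (n (Suc (Suc m)) * sqrt N) =
     \<bar>(R - n (Suc (Suc m)) * (c * sqrt (s (Suc m)))) / (n (Suc (Suc m)) * sqrt N)\<bar>"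
    using N by simp
  also have "(R - n (Suc (Suc m)) * (c * sqrt (s (Suc m)))) / (n (Suc (Suc m)) * sqrt N) =
     inverse (n (Suc (Suc m))) * N powr (- (1/2)) * R - c * t"
    using n[of "Suc (Suc m)"] N
    by (simp add: t_def real_sqrt_divide powr_minus powr_half_sqrt diff_divide_distrib) (simp add: field_simps)
  finally have 1: "\<bar>inverse (n (Suc (Suc m))) * N powr (- (1/2)) * R - c * t\<bar> \<le> \<epsilon> * t" .
  \<comment> \<open>The final multiplication contributes \<epsilon> * t, and the norm error is not
    amplified as c \<le> 1. With t \<le> (1 + \<epsilon>) ^ Suc m the two combine like one further
    step of the accumulation.\<close>
  have "\<epsilon> * t \<le> \<epsilon> * (1 + \<epsilon>) ^ Suc m" using t \<epsilon> by (intro mult_left_mono) auto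
  moreover have "\<bar>c * t - c\<bar> \<le> \<bar>t - 1\<bar>"
  proof -
    have "c * t - c = c * (t - 1)" by (simp add: algebra_simps)
    then have "\<bar>c * t - c\<bar> = c * \<bar>t - 1\<bar>" using c by (simp add: abs_mult)
    also have "\<dots> \<le> 1 * \<bar>t - 1\<bar>" using c by (intro mult_right_mono) auto
    finally show ?thesis by simp
  qed
  ultimately have "\<bar>inverse (n (Suc (Suc m))) * N powr (- (1/2)) * R - c\<bar> \<le>
      \<epsilon> * (1 + \<epsilon>) ^ Suc m + ((1 + \<epsilon>) ^ Suc m - 1)" using 1 t by linarith
  also have "\<dots> = (1 + \<epsilon>) ^ Suc (Suc m) - 1" by (simp add: algebra_simps)
  finally show ?thesis by (simp add: N_def R_def c_def x_def)
qed

section \<open>Conditioning on the preceding matrices\<close>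

context prob_space begin

text \<open>The row after q multiplications is a function of the matrices 1 to q, which are
  independent of the matrix q + 1. Freezing the row therefore transfers a bound valid for every
  fixed vector x.\<close>

lemma prob_bad_row_le:
  fixes a :: "nat \<Rightarrow> 'a \<Rightarrow> nat \<times> nat \<Rightarrow> real" and n :: "nat \<Rightarrow> nat"
  assumes ind: "indep_vars (\<lambda>r. PiM ({..<n (r - 1)} \<times> {..<n r}) (\<lambda>_. borel))
      (\<lambda>r \<omega>. restrict (a r \<omega>) ({..<n (r - 1)} \<times> {..<n r})) {1..p}"
    and q: "q < p"
    and meas: "Measurable.pred (PiM {..<n q} (\<lambda>_. borel) \<Otimes>\<^sub>M PiM ({..<n q} \<times> {..<n (Suc q)}) (\<lambda>_. borel))
      (\<lambda>z. Q (fst z) (snd z))"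
    and restr: "\<And>x f. Q (restrict x {..<n q}) (restrict f ({..<n q} \<times> {..<n (Suc q)})) = Q x f"
      "\<And>x f. Q x (restrict f ({..<n q} \<times> {..<n (Suc q)})) = Q x f"
    and le: "\<And>x. prob {\<omega> \<in> space M. Q x (a (Suc q) \<omega>)} \<le> b"
  shows "{\<omega> \<in> space M. Q (rowvec n (\<lambda>r. a r \<omega>) i q) (a (Suc q) \<omega>)} \<in> events"
    and "prob {\<omega> \<in> space M. Q (rowvec n (\<lambda>r. a r \<omega>) i q) (a (Suc q) \<omega>)} \<le> b"
proof -
  define I where "I r = {..<n (r - 1)} \<times> {..<n r}" for r
  define E where "E \<omega> r = restrict (a r \<omega>) (I r)" for \<omega> r
  define F where "F K \<omega> = restrict (E \<omega>) K" for K \<omega>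
  define S where "S K = PiM K (\<lambda>r. PiM (I r) (\<lambda>_. borel :: real measure))" for K
  \<comment> \<open>The failure as a predicate on two restricted families of matrices, one over
    {1..q} and one over the single index q + 1, the form in which independence of disjoint blocks is
    provided.\<close>
  define Q' where "Q' f g = Q (\<lambda>j\<in>{..<n q}. rowvec n f i q j) (g (Suc q))" for f g
  have I: "I (Suc q) = {..<n q} \<times> {..<n (Suc q)}" by (simp add: I_def)
  note meas = meas[folded I] and restr = restr[folded I]
  have XY: "indep_var (S {1..q}) (F {1..q}) (S {Suc q}) (F {Suc q})"
    unfolding S_def F_def E_def by (rule indep_var_restrict[OF ind[folded I_def]]) (use q in auto)
  then have F[measurable]: "F {1..q} \<in> measurable M (S {1..q})" "F {Suc q} \<in> measurable M (S {Suc q})"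
    by (auto simp: indep_var_distribution_eq)
  have [measurable]: "(\<lambda>f. \<lambda>j\<in>{..<n q}. rowvec n f i q j) \<in> measurable (S {1..q}) (PiM {..<n q} (\<lambda>_. borel))"
    unfolding S_def I_def by (intro measurable_restrict measurable_rowvec) auto
  have [measurable]: "(\<lambda>f. f (Suc q)) \<in> measurable (S {Suc q}) (PiM (I (Suc q)) (\<lambda>_. borel))"
    unfolding S_def by (rule measurable_component_singleton) simp
  have Q'[measurable]: "Measurable.pred (S {1..q} \<Otimes>\<^sub>M S {Suc q}) (\<lambda>z. Q' (fst z) (snd z))"
  proof -
    have "(\<lambda>z. ((\<lambda>j\<in>{..<n q}. rowvec n (fst z) i q j), snd z (Suc q))) \<in>
      measurable (S {1..q} \<Otimes>\<^sub>M S {Suc q}) (PiM {..<n q} (\<lambda>_. borel) \<Otimes>\<^sub>M PiM (I (Suc q)) (\<lambda>_. borel))"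
      by measurable
    from measurable_compose[OF this meas] show ?thesis by (simp add: Q'_def)
  qed
  have row: "(\<lambda>j\<in>{..<n q}. rowvec n (F {1..q} \<omega>) i q j) = restrict (rowvec n (\<lambda>r. a r \<omega>) i q) {..<n q}" for \<omega>
  proof (rule restrict_ext)
    fix j assume "j \<in> {..<n q}"
    then show "rowvec n (F {1..q} \<omega>) i q j = rowvec n (\<lambda>r. a r \<omega>) i q j"
      by (intro rowvec_cong) (auto simp: F_def E_def I_def)
  qed
  have eq: "Q (rowvec n (\<lambda>r. a r \<omega>) i q) (a (Suc q) \<omega>) = Q' (F {1..q} \<omega>) (F {Suc q} \<omega>)" for \<omega>
    unfolding Q'_def row by (simp add: F_def E_def restr(1))
  have "Measurable.pred M (\<lambda>\<omega>. Q' (fst (F {1..q} \<omega>, F {Suc q} \<omega>)) (snd (F {1..q} \<omega>, F {Suc q} \<omega>)))"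
    by (rule measurable_compose[OF _ Q']) measurable
  then show "{\<omega> \<in> space M. Q (rowvec n (\<lambda>r. a r \<omega>) i q) (a (Suc q) \<omega>)} \<in> events"
    unfolding eq by (simp add: pred_def)
  show "prob {\<omega> \<in> space M. Q (rowvec n (\<lambda>r. a r \<omega>) i q) (a (Suc q) \<omega>)} \<le> b"
    unfolding eq
  proof (rule prob_indep_var_le[OF XY Q'])
    fix f
    show "prob {\<omega> \<in> space M. Q' f (F {Suc q} \<omega>)} \<le> b"
      unfolding Q'_def by (simp add: F_def E_def restr le)
  qed
qed

end

section \<open>Union bound over the rows\<close>

theorem theorem1p4:
  fixes \<alpha> :: real and p :: nat
    and \<mu> :: "nat \<Rightarrow> real measure"
    and M :: "'w measure"
    and A :: "nat list \<Rightarrow> nat \<Rightarrow> 'w \<Rightarrow> real mat"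
  assumes "\<alpha> > 1" and "p \<ge> 2"
    and "\<And>q. q \<in> {1..p} \<Longrightarrow> centered_unit_variance_law (\<mu> q)"
    and "\<And>q. q \<in> {1..p - 1} \<Longrightarrow> finite_moment (\<mu> q) (4 * \<alpha>)"
    and "finite_moment (\<mu> p) (2 * \<alpha>)"
    and "prob_space M"
    and "\<And>ns q. length ns = p + 1 \<Longrightarrow> (\<forall>k\<in>{0..p}. ns ! k \<ge> 1) \<Longrightarrow> q \<in> {1..p} \<Longrightarrow>
           iid_entries M (ns ! (q - 1)) (ns ! q) (\<mu> q) (A ns q)"
    and "\<And>ns. length ns = p + 1 \<Longrightarrow> (\<forall>k\<in>{0..p}. ns ! k \<ge> 1) \<Longrightarrow> indep_matrices M p ns (A ns)"
  shows "conv_prob_comparable M p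
           (\<lambda>ns \<omega>. inverse (real (ns ! p)) * (\<Prod>q=1..p-1. real (ns ! q)) powr (- (1/2)) *
             op_norm_inf (mat_product p (\<lambda>q. A ns q \<omega>)))
           (\<lambda>_. sqrt (2 / pi))"
proof -
  interpret prob_space M by fact
  \<comment> \<open>The matrices 1 to Suc m have moments of order 4 * \<alpha>. The one with index
    Suc m also has to spread out the entries, for the sake of the last, whose index is Suc (Suc
    m).\<close>
  obtain m where p: "p = Suc (Suc m)" using \<open>p \<ge> 2\<close> by (metis add_2_eq_Suc le_Suc_ex)
  have p1: "1 \<le> p" "p \<le> p" "1 \<le> Suc m" "Suc m \<le> p" "Suc m \<le> Suc m" using p by auto
  have law: "centered_unit_variance_law (\<mu> q)" if "1 \<le> q" "q \<le> p" for q using assms(3) that by simp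
  have moment: "finite_moment (\<mu> q) (4 * \<alpha>)" if "1 \<le> q" "q \<le> Suc m" for q using assms(4) that p by simp
  show ?thesis
    unfolding conv_prob_comparable_def
  proof (intro allI impI, elim conjE)
    fix C \<epsilon>0 \<delta> :: real
    assume \<epsilon>0: "\<epsilon>0 > 0" and \<delta>: "\<delta> > 0"
    \<comment> \<open>Relative errors of \<epsilon> accumulate over p multiplications to (1 +
      \<epsilon>) ^ p - 1, which tends to 0 with \<epsilon>.\<close>
    obtain \<epsilon> where \<epsilon>: "0 < \<epsilon>" "\<epsilon> \<le> 1/2" "(1 + \<epsilon>) ^ p - 1 < \<epsilon>0"
    proof -
      have "((\<lambda>e::real. (1 + e) ^ p - 1) \<longlongrightarrow> (1 + 0) ^ p - 1) (at_right 0)"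
        by (intro tendsto_intros)
      then have "\<forall>\<^sub>F e in at_right (0::real). (1 + e) ^ p - 1 < \<epsilon>0"
        using \<epsilon>0 by (intro order_tendstoD(2)) auto
      moreover have "\<forall>\<^sub>F e in at_right (0::real). 0 < e" by (rule eventually_at_right_less)
      moreover have "\<forall>\<^sub>F e in at_right (0::real). e < 1/2"
        by (rule order_tendstoD(2)[OF tendsto_ident_at]) simp
      ultimately have "\<forall>\<^sub>F e in at_right (0::real). 0 < e \<and> e \<le> 1/2 \<and> (1 + e) ^ p - 1 < \<epsilon>0"
        by eventually_elim auto
      then show thesis using that eventually_happens'[OF trivial_limit_at_right_real] by blast
    qed
    \<comment> \<open>The last matrix comes first: its limit theorem dictates \<eta>, which the
      matrix before it must then achieve.\<close>
    obtain \<eta> L3 where \<eta>: "\<eta> > 0" and L3: "L3 \<ge> 0"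
      "\<And>(X :: nat \<times> nat \<Rightarrow> 'w \<Rightarrow> real) m n x. n > 0 \<Longrightarrow> indep_vars (\<lambda>_. borel) X ({..<m} \<times> {..<n}) \<Longrightarrow>
       (\<And>ij. ij \<in> {..<m} \<times> {..<n} \<Longrightarrow> distr M borel (X ij) = \<mu> p) \<Longrightarrow>
       prob {\<omega> \<in> space M. bad_sum \<epsilon> \<eta> m n x (\<lambda>ij. X ij \<omega>)} \<le> L3 * real n powr (- \<alpha>)"
      using prob_abs_sum_deviation_le[OF law \<open>finite_moment (\<mu> p) (2 * \<alpha>)\<close> \<open>\<alpha> > 1\<close> \<epsilon>(1)] p1 by blast
    have "\<eta> / 2 > 0" using \<eta> by simp
    then obtain L2 where L2: "L2 \<ge> 0"
      "\<And>(X :: nat \<times> nat \<Rightarrow> 'w \<Rightarrow> real) m' n x. n > 0 \<Longrightarrow> indep_vars (\<lambda>_. borel) X ({..<m'} \<times> {..<n}) \<Longrightarrow>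
       (\<And>ij. ij \<in> {..<m'} \<times> {..<n} \<Longrightarrow> distr M borel (X ij) = \<mu> (Suc m)) \<Longrightarrow>
       prob {\<omega> \<in> space M. bad_entry (\<eta> / 2) m' n x (\<lambda>ij. X ij \<omega>)} \<le> L2 * real n powr (- \<alpha>)"
      using prob_large_entry_le[OF law moment \<open>\<alpha> > 1\<close>, of "Suc m" "\<eta> / 2"] p1 by blast
    \<comment> \<open>Each law has its own constant; as a closed predicate the bound can be handed
      to \<open>bchoice\<close>, which collects the constants into a function of q.\<close>
    define norm_rate where "norm_rate q L \<longleftrightarrow> L \<ge> 0 \<and>
      (\<forall>(X :: nat \<times> nat \<Rightarrow> 'w \<Rightarrow> real) m' n x. n > 0 \<longrightarrow> indep_vars (\<lambda>_. borel) X ({..<m'} \<times> {..<n}) \<longrightarrow>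
        (\<forall>ij\<in>{..<m'} \<times> {..<n}. distr M borel (X ij) = \<mu> q) \<longrightarrow>
        prob {\<omega> \<in> space M. bad_norm \<epsilon> m' n x (\<lambda>ij. X ij \<omega>)} \<le> L * real n powr (- \<alpha>))" for q L
    have "\<exists>L. norm_rate q L" if q: "q \<in> {1..Suc m}" for q
    proof -
      have q': "1 \<le> q" "q \<le> Suc m" "q \<le> p" using q p by auto
      show ?thesis
        by (rule prob_norm_deviation_le[OF law[OF q'(1,3)] moment[OF q'(1,2)] \<open>\<alpha> > 1\<close> \<epsilon>(1)])
          (unfold norm_rate_def, blast)
    qed
    then have "\<exists>L1. \<forall>q\<in>{1..Suc m}. norm_rate q (L1 q)" by (intro bchoice ballI)
    then obtain L1 where L1_rate: "\<And>q. q \<in> {1..Suc m} \<Longrightarrow> norm_rate q (L1 q)" by blast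
    have L1: "L1 q \<ge> 0"
      "n > 0 \<Longrightarrow> indep_vars (\<lambda>_. borel) X ({..<m'} \<times> {..<n}) \<Longrightarrow>
       (\<forall>ij\<in>{..<m'} \<times> {..<n}. distr M borel (X ij) = \<mu> q) \<Longrightarrow>
       prob {\<omega> \<in> space M. bad_norm \<epsilon> m' n x (\<lambda>ij. X ij \<omega>)} \<le> L1 q * real n powr (- \<alpha>)"
      if "1 \<le> q" "q \<le> Suc m" for q n m' x and X :: "nat \<times> nat \<Rightarrow> 'w \<Rightarrow> real"
      using L1_rate[of q] that unfolding norm_rate_def by auto
    define L where "L = (\<Sum>q<Suc m. L1 (Suc q)) + L2 + L3"
    \<comment> \<open>L * (C * N powr (1 - \<alpha>)) will bound the total failure probability of
      all n 0 rows; it vanishes as N grows because \<alpha> > 1. N \<ge> 1 ensures that all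
      dimensions are positive.\<close>
    obtain N where N: "N \<ge> 1" "L * (C * real N powr (1 - \<alpha>)) \<le> \<delta>"
    proof -
      have "(\<lambda>N. real N powr (1 - \<alpha>)) \<longlonglongrightarrow> 0"
        using \<open>\<alpha> > 1\<close> by (intro tendsto_neg_powr filterlim_real_sequentially) simp
      then have "(\<lambda>N. L * (C * real N powr (1 - \<alpha>))) \<longlonglongrightarrow> 0"
        by (intro tendsto_mult_right_zero)
      then have "\<forall>\<^sub>F N in sequentially. L * (C * real N powr (1 - \<alpha>)) < \<delta>"
        using \<delta> by (rule order_tendstoD(2))
      with eventually_ge_at_top[of "1::nat"]
      have "\<forall>\<^sub>F N in sequentially. N \<ge> 1 \<and> L * (C * real N powr (1 - \<alpha>)) \<le> \<delta>"
        by eventually_elim auto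
      then show thesis using that eventually_happens'[OF sequentially_bot] by blast
    qed
    show "\<exists>N. \<forall>ns. length ns = p + 1 \<and>
          (\<forall>q\<in>{0..p}. \<forall>q'\<in>{0..p}. N \<le> ns ! q \<and> real (ns ! q) \<le> C * real (ns ! q')) \<longrightarrow>
          prob {\<omega> \<in> space M. \<bar>inverse (real (ns ! p)) * (\<Prod>q=1..p-1. real (ns ! q)) powr (- (1/2)) *
             op_norm_inf (mat_product p (\<lambda>q. A ns q \<omega>)) - sqrt (2 / pi)\<bar> \<ge> \<epsilon>0} \<le> \<delta>"
    proof (intro exI[of _ N] allI impI, elim conjE)
      fix ns :: "nat list"
      assume len: "length ns = p + 1"
        and big: "\<forall>q\<in>{0..p}. \<forall>q'\<in>{0..p}. N \<le> ns ! q \<and> real (ns ! q) \<le> C * real (ns ! q')"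
      define n where "n = (!) ns"
      define a where "a r \<omega> ij = A ns r \<omega> $$ ij" for r \<omega> ij
      have nN: "N \<le> n q" if "q \<le> p" for q using big that by (auto simp: n_def)
      have n0: "n q > 0" if "q \<le> p" for q using nN[OF that] N(1) by simp
      have nC: "real (n 0) \<le> C * real (n q)" if "q \<le> p" for q using big that by (auto simp: n_def)
      have ge1: "\<forall>k\<in>{0..p}. ns ! k \<ge> 1" using n0 by (auto simp: n_def Suc_le_eq)
      have iid: "iid_entries M (n (q - 1)) (n q) (\<mu> q) (A ns q)" if "1 \<le> q" "q \<le> p" for q
        using assms(7)[OF len ge1, of q] that by (simp add: n_def)
      have indX: "indep_vars (\<lambda>_. borel) (\<lambda>ij \<omega>. a (Suc q) \<omega> ij) ({..<n q} \<times> {..<n (Suc q)})"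
        and distrX: "\<forall>ij\<in>{..<n q} \<times> {..<n (Suc q)}. distr M borel (\<lambda>\<omega>. a (Suc q) \<omega> ij) = \<mu> (Suc q)"
        if "q < p" for q
        using iid[of "Suc q"] that by (auto simp: iid_entries_def a_def)
      have ind: "indep_vars (\<lambda>r. PiM ({..<n (r - 1)} \<times> {..<n r}) (\<lambda>_. borel))
          (\<lambda>r \<omega>. restrict (a r \<omega>) ({..<n (r - 1)} \<times> {..<n r})) {1..p}"
        using assms(8)[OF len ge1] unfolding indep_matrices_def n_def a_def .
      have rate: "n 0 * n q powr (- \<alpha>) \<le> C * N powr (1 - \<alpha>)" if "q \<le> p" for q
      proof -
        \<comment> \<open>The sign of C is not given in advance; comparability of positive
          dimensions forces it.\<close>
        have "0 < C * n q" using nC[OF that] n0[of 0] by simp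
        then have C: "C \<ge> 0" using n0[OF that] by (simp add: zero_less_mult_iff)
        have "n 0 * n q powr (- \<alpha>) \<le> C * n q * n q powr (- \<alpha>)"
          using nC[OF that] by (intro mult_right_mono) auto
        also have "\<dots> = C * (n q powr 1 * n q powr (- \<alpha>))" using n0[OF that] by simp
        also have "\<dots> = C * n q powr (1 - \<alpha>)" by (simp only: powr_add[symmetric]) simp
        also have "\<dots> \<le> C * N powr (1 - \<alpha>)"
          using C N(1) nN[OF that] \<open>\<alpha> > 1\<close> by (intro mult_left_mono powr_mono2') auto
        finally show ?thesis .
      qed
      define B1 where "B1 i q = {\<omega> \<in> space M. bad_norm \<epsilon> (n q) (n (Suc q)) (rowvec n (\<lambda>r. a r \<omega>) i q) (a (Suc q) \<omega>)}" for i q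
      define B2 where "B2 i = {\<omega> \<in> space M. bad_entry (\<eta> / 2) (n m) (n (Suc m)) (rowvec n (\<lambda>r. a r \<omega>) i m) (a (Suc m) \<omega>)}" for i
      define B3 where "B3 i = {\<omega> \<in> space M. bad_sum \<epsilon> \<eta> (n (Suc m)) (n p) (rowvec n (\<lambda>r. a r \<omega>) i (Suc m)) (a p \<omega>)}" for i
      have B1: "B1 i q \<in> events \<and> prob (B1 i q) \<le> L1 (Suc q) * n (Suc q) powr (- \<alpha>)" if "q < Suc m" for i q
      proof -
        have q: "q < p" "Suc q \<le> Suc m" "0 < n (Suc q)" using that p n0 by auto
        note * = prob_bad_row_le[OF ind q(1) measurable_bad(1) bad_restrict(1) bad_restrict(4)
          L1(2)[OF _ q(2,3) indX[OF q(1)] distrX[OF q(1)]]]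
        show ?thesis unfolding B1_def using * by simp
      qed
      have B2: "B2 i \<in> events \<and> prob (B2 i) \<le> L2 * n (Suc m) powr (- \<alpha>)" for i
      proof -
        have q: "m < p" "0 < n (Suc m)" using p n0 by auto
        note * = prob_bad_row_le[OF ind q(1) measurable_bad(2) bad_restrict(2) bad_restrict(5)
          L2(2)[OF q(2) indX[OF q(1)] distrX[OF q(1), rule_format]]]
        show ?thesis unfolding B2_def using * by simp
      qed
      have B3: "B3 i \<in> events \<and> prob (B3 i) \<le> L3 * n p powr (- \<alpha>)" for i
      proof -
        have q: "Suc m < p" "0 < n (Suc (Suc m))" using p n0 by auto
        note * = prob_bad_row_le[OF ind q(1) measurable_bad(3) bad_restrict(3) bad_restrict(6)
          L3(2)[unfolded p, OF q(2) indX[OF q(1)] distrX[OF q(1), rule_format]]]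
        show ?thesis unfolding B3_def using * by (simp add: p)
      qed
      define B where "B i = (\<Union>q<Suc m. B1 i q) \<union> (B2 i \<union> B3 i)" for i
      have B_events: "B i \<in> events" for i
        unfolding B_def using B1 B2 B3 by (intro sets.Un sets.finite_UN) auto
      have B_prob: "n 0 * prob (B i) \<le> L * (C * N powr (1 - \<alpha>))" for i
      proof -
        have "prob (B i) \<le> prob (\<Union>q<Suc m. B1 i q) + prob (B2 i \<union> B3 i)"
          unfolding B_def using B1 B2 B3 by (intro measure_Un_le sets.Un sets.finite_UN) auto
        also have "prob (\<Union>q<Suc m. B1 i q) \<le> (\<Sum>q<Suc m. prob (B1 i q))"
          using B1 by (intro finite_measure_subadditive_finite) auto
        also have "(\<Sum>q<Suc m. prob (B1 i q)) \<le> (\<Sum>q<Suc m. L1 (Suc q) * n (Suc q) powr (- \<alpha>))"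
          using B1 by (intro sum_mono) auto
        also have "prob (B2 i \<union> B3 i) \<le> prob (B2 i) + prob (B3 i)"
          using B2 B3 by (intro measure_Un_le) auto
        also have "\<dots> \<le> L2 * n (Suc m) powr (- \<alpha>) + L3 * n p powr (- \<alpha>)"
          using B2 B3 by (intro add_mono) auto
        finally have "n 0 * prob (B i) \<le> n 0 * ((\<Sum>q<Suc m. L1 (Suc q) * n (Suc q) powr (- \<alpha>)) +
            (L2 * n (Suc m) powr (- \<alpha>) + L3 * n p powr (- \<alpha>)))"
          by (intro mult_left_mono) auto
        also have "\<dots> = (\<Sum>q<Suc m. L1 (Suc q) * (n 0 * n (Suc q) powr (- \<alpha>))) +
            (L2 * (n 0 * n (Suc m) powr (- \<alpha>)) + L3 * (n 0 * n p powr (- \<alpha>)))"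
          by (simp only: distrib_left sum_distrib_left mult.left_commute)
        also have "\<dots> \<le> (\<Sum>q<Suc m. L1 (Suc q) * (C * N powr (1 - \<alpha>))) +
            (L2 * (C * N powr (1 - \<alpha>)) + L3 * (C * N powr (1 - \<alpha>)))"
          using L1(1) L2(1) L3(1) p by (intro add_mono sum_mono mult_left_mono rate) auto
        also have "\<dots> = L * (C * N powr (1 - \<alpha>))"
          unfolding L_def by (simp only: distrib_right sum_distrib_right add.assoc)
        finally show ?thesis .
      qed
      \<comment> \<open>The operator norm is attained at a row i that depends on the outcome. If no
        row fails, the bound for that row settles deviations in both directions.\<close>
      have sub: "{\<omega> \<in> space M. \<bar>inverse (real (ns ! p)) * (\<Prod>q=1..p-1. real (ns ! q)) powr (- (1/2)) *
             op_norm_inf (mat_product p (\<lambda>q. A ns q \<omega>)) - sqrt (2 / pi)\<bar> \<ge> \<epsilon>0} \<subseteq> (\<Union>i<n 0. B i)"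
      proof (rule subsetI, rule ccontr)
        fix \<omega> assume "\<omega> \<in> {\<omega> \<in> space M. \<bar>inverse (real (ns ! p)) * (\<Prod>q=1..p-1. real (ns ! q)) powr (- (1/2)) *
             op_norm_inf (mat_product p (\<lambda>q. A ns q \<omega>)) - sqrt (2 / pi)\<bar> \<ge> \<epsilon>0}"
        then have \<omega>: "\<omega> \<in> space M" and far: "\<bar>inverse (real (n p)) * (\<Prod>q=1..Suc m. real (n q)) powr (- (1/2)) *
             op_norm_inf (mat_product p (\<lambda>q. A ns q \<omega>)) - sqrt (2 / pi)\<bar> \<ge> \<epsilon>0"
          by (simp_all add: n_def p)
        assume good: "\<omega> \<notin> (\<Union>i<n 0. B i)"
        define P where "P = mat_product p (\<lambda>q. A ns q \<omega>)"
        define R where "R i = (\<Sum>j<n p. \<bar>rowvec n (\<lambda>r. a r \<omega>) i p j\<bar>)" for i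
        have P: "P \<in> carrier_mat (n 0) (n p)"
          "\<And>i j. i < n 0 \<Longrightarrow> j < n p \<Longrightarrow> P $$ (i, j) = rowvec n (\<lambda>r. a r \<omega>) i p j"
          using mat_product_rowvec[of p "\<lambda>q. A ns q \<omega>" n] iid \<omega> p
          by (auto simp: P_def a_def[abs_def] iid_entries_def)
        have "op_norm_inf P = Max ((\<lambda>i. \<Sum>j<n p. \<bar>P $$ (i, j)\<bar>) ` {..<n 0})"
          using op_norm_inf_eq_Max[of P] P(1) n0 by simp
        also have "(\<lambda>i. \<Sum>j<n p. \<bar>P $$ (i, j)\<bar>) ` {..<n 0} = R ` {..<n 0}"
          unfolding R_def using P(2) by (intro image_cong sum.cong) auto
        finally have "op_norm_inf P = Max (R ` {..<n 0})" .
        moreover have "Max (R ` {..<n 0}) \<in> R ` {..<n 0}"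
          using n0[of 0] by (intro Max_in) (auto simp: lessThan_empty_iff)
        ultimately have "op_norm_inf P \<in> R ` {..<n 0}" by simp
        then obtain i where i: "i < n 0" and eq: "op_norm_inf P = R i" by auto
        have "\<bar>inverse (real (n p)) * (\<Prod>q=1..Suc m. real (n q)) powr (- (1/2)) * R i - sqrt (2 / pi)\<bar>
            \<le> (1 + \<epsilon>) ^ p - 1"
          unfolding R_def p
        proof (rule row_sum_deviation_le[where n = n and m = m, OF \<epsilon>(1,2) \<eta> _ i])
          have nB: "\<omega> \<notin> B i" using good i by blast
          show "\<not> bad_norm \<epsilon> (n q) (n (Suc q)) (rowvec n (\<lambda>r. a r \<omega>) i q) (a (Suc q) \<omega>)" if "q < Suc m" for q
            using nB \<omega> that by (auto simp: B_def B1_def)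
          show "\<not> bad_entry (\<eta> / 2) (n m) (n (Suc m)) (rowvec n (\<lambda>r. a r \<omega>) i m) (a (Suc m) \<omega>)"
            using nB \<omega> by (auto simp: B_def B2_def)
          show "\<not> bad_sum \<epsilon> \<eta> (n (Suc m)) (n (Suc (Suc m))) (rowvec n (\<lambda>r. a r \<omega>) i (Suc m)) (a (Suc (Suc m)) \<omega>)"
            using nB \<omega> by (auto simp: B_def B3_def p)
        qed (use n0 p in auto)
        then show False using far \<epsilon>(3) by (simp add: eq[unfolded P_def])
      qed
      \<comment> \<open>Monotonicity of the measure asks for measurability of the larger set, which
        \<open>B_events\<close> supplies.\<close>
      have "prob {\<omega> \<in> space M. \<bar>inverse (real (ns ! p)) * (\<Prod>q=1..p-1. real (ns ! q)) powr (- (1/2)) *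
             op_norm_inf (mat_product p (\<lambda>q. A ns q \<omega>)) - sqrt (2 / pi)\<bar> \<ge> \<epsilon>0} \<le> prob (\<Union>i<n 0. B i)"
        using B_events by (intro finite_measure_mono[OF sub] sets.finite_UN) auto
      also have "\<dots> \<le> (\<Sum>i<n 0. prob (B i))"
        using B_events by (intro finite_measure_subadditive_finite) auto
      also have "\<dots> \<le> (\<Sum>i<n 0. L * (C * N powr (1 - \<alpha>)) / n 0)"
        using B_prob n0[of 0] by (intro sum_mono) (simp add: le_divide_eq mult.commute)
      also have "\<dots> = L * (C * N powr (1 - \<alpha>))" using n0[of 0] by simp
      also have "\<dots> \<le> \<delta>" by (rule N(2))
      finally show "prob {\<omega> \<in> space M. \<bar>inverse (real (ns ! p)) * (\<Prod>q=1..p-1. real (ns ! q)) powr (- (1/2)) *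
             op_norm_inf (mat_product p (\<lambda>q. A ns q \<omega>)) - sqrt (2 / pi)\<bar> \<ge> \<epsilon>0} \<le> \<delta>" .
    qed
  qed
qed

end
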